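(* Let $T\in\mathcal{CPMM}$, let $\mathcal P$ be a Markov partition for $T$, and let $M$ be the transition matrix of $T$ with respect to $\mathcal P$. Then $\lambda_M=e^{h_{top}(T)}$, and if there is a summable $\lambda$-solution for $M$ then $\lambda_M\le\lambda$.
   Context: A continuous map on a closed interval is piecewise monotone if the interval splits into finitely many subintervals on each of which the map is monotone. A Markov partition for a continuous map $T:[0,1]\to[0,1]$ is a finite or countably infinite collection $\mathcal P$ of closed nondegenerate subintervals of $[0,1]$ such that: (1) distinct elements of $\mathcal P$ have disjoint interiors and $[0,1]\setminus\bigcup\mathcal P$ is at most countable; (2) $T|_i$ is monotone for each $i\in\mathcal P$ (classical), or piecewise monotone for each $i\in\mathcal P$ (slack); (3) for all $i,j\in\mathcal P$ and every maximal interval $i'\subset i$ of monotonicity of $T$, if $T(i')\cap j^\circ\ne\emptyset$ then $T(i')\supset j$. $\mathcal{CPMM}$ is the set of continuous maps $T:[0,1]\to[0,1]$ that are topologically mixing (for all nonempty open $U,V$ there is $n$ with $T^m(U)\cap V\neq\emptyset$ for all $m\ge n$), admit a countably infinite Markov partition, and have finite topological entropy $h_{top}(T)<\infty$. Transition matrix of $T$ with respect to $\mathcal P$: $M=(m_{ij})_{i,j\in\mathcal P}$, where $m_{ij}=0$ if $T(i)\not\supset j$, and otherwise $m_{ij}$ is the maximal number of intervals $i_1,\dots,i_\kappa\subset i$ with pairwise disjoint interiors such that each $T|_{i_\ell}$ is monotone and $T(i_\ell)\supset j$ (this number is finite). Write $M^n=(m_{ij}(n))_{i,j\in\mathcal P}$.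 Since $T$ is mixing, $M$ is irreducible and aperiodic, and its Perron value is the common value $\lambda_M=\lim_{n\to\infty}[m_{ij}(n)]^{1/n}=\sup_{n\ge1}[m_{ii}(n)]^{1/n}$ (independent of $i,j$). For $\lambda>0$, a $\lambda$-solution for $M$ is a nonzero nonnegative sequence $v=(v_i)_{i\in\mathcal P}$ with $\sum_{j\in\mathcal P}m_{ij}v_j=\lambda v_i$ for all $i\in\mathcal P$; it is summable if $v\in\ell^1(\mathcal P)$. *)

theory Defs
  imports "HOL-Analysis.Analysis"
begin

definition monotone_map_on :: "(real \<Rightarrow> real) \<Rightarrow> real set \<Rightarrow> bool" where
  "monotone_map_on T S \<longleftrightarrow> mono_on S T \<or> antimono_on S T"

definition piecewise_monotone_on :: "(real \<Rightarrow> real) \<Rightarrow> real set \<Rightarrow> bool" where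
  "piecewise_monotone_on T i \<longleftrightarrow> (\<exists>D. D division_of i \<and> (\<forall>K\<in>D. monotone_map_on T K))"

definition maximal_monotone_interval :: "(real \<Rightarrow> real) \<Rightarrow> real set \<Rightarrow> real set \<Rightarrow> bool" where
  "maximal_monotone_interval T i K \<longleftrightarrow>
     is_interval K \<and> K \<subseteq> i \<and> monotone_map_on T K \<and>
     (\<forall>K'. is_interval K' \<and> K' \<subseteq> i \<and> monotone_map_on T K' \<and> K \<subseteq> K' \<longrightarrow> K' = K)"

definition classical_on :: "(real \<Rightarrow> real) \<Rightarrow> real set set \<Rightarrow> bool" where
  "classical_on T P \<longleftrightarrow> (\<forall>i\<in>P. monotone_map_on T i)"

definition slack_on :: "(real \<Rightarrow> real) \<Rightarrow> real set set \<Rightarrow> bool" where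
  "slack_on T P \<longleftrightarrow> (\<forall>i\<in>P. piecewise_monotone_on T i)"

definition markov_partition :: "(real \<Rightarrow> real) \<Rightarrow> real set set \<Rightarrow> bool" where
  "markov_partition T P \<longleftrightarrow>
     countable P \<and>
     (\<forall>i\<in>P. \<exists>a b. 0 \<le> a \<and> a < b \<and> b \<le> 1 \<and> i = {a..b}) \<and>
     pairwise (\<lambda>i j. interior i \<inter> interior j = {}) P \<and>
     countable ({0..1} - \<Union>P) \<and>
     (classical_on T P \<or> slack_on T P) \<and>
     (\<forall>i\<in>P. \<forall>j\<in>P. \<forall>K. maximal_monotone_interval T i K \<longrightarrow>
        T ` K \<inter> interior j \<noteq> {} \<longrightarrow> j \<subseteq> T ` K)"

definition topologically_mixing_on :: "'a::topological_space set \<Rightarrow> ('a \<Rightarrow> 'a) \<Rightarrow> bool" where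
  "topologically_mixing_on X T \<longleftrightarrow>
     (\<forall>U V. openin (top_of_set X) U \<and> U \<noteq> {} \<and> openin (top_of_set X) V \<and> V \<noteq> {} \<longrightarrow>
        (\<exists>n. \<forall>m\<ge>n. (T ^^ m) ` U \<inter> V \<noteq> {}))"

definition separated_set :: "'a::metric_space set \<Rightarrow> ('a \<Rightarrow> 'a) \<Rightarrow> nat \<Rightarrow> real \<Rightarrow> 'a set \<Rightarrow> bool" where
  "separated_set X T n e E \<longleftrightarrow>
     E \<subseteq> X \<and> (\<forall>x\<in>E. \<forall>y\<in>E. x \<noteq> y \<longrightarrow> (\<exists>k<n. e < dist ((T ^^ k) x) ((T ^^ k) y)))"

text \<open>
  Bowen's definition of topological entropy.  The inner supremum is \<open>(1/n) ln s(n, e)\<close>, where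
  \<open>s(n, e)\<close> is the maximal cardinality of an \<open>(n, e)\<close>-separated set; the supremum over
  \<open>e > 0\<close> is the limit for \<open>e\<close> tending to \<open>0\<close>, by monotonicity in \<open>e\<close>.
\<close>

definition top_entropy :: "'a::metric_space set \<Rightarrow> ('a \<Rightarrow> 'a) \<Rightarrow> ereal" where
  "top_entropy X T =
     (SUP e\<in>{0::real<..}. limsup (\<lambda>n.
        SUP E\<in>{E. finite E \<and> separated_set X T n e E}. ereal (ln (real (card E)) / real n)))"

definition CPMM :: "(real \<Rightarrow> real) set" where
  "CPMM = {T. continuous_on {0..1} T \<and> T ` {0..1} \<subseteq> {0..1} \<and>
              topologically_mixing_on {0..1} T \<and>
              (\<exists>P. infinite P \<and> markov_partition T P) \<and>
              top_entropy {0..1} T < \<infinity>}"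

text \<open>
  The set of cardinalities is bounded when \<open>T\<close> is piecewise monotone on \<open>i\<close> and
  \<open>j\<close> is nondegenerate, so that \<^const>\<open>Max\<close> is meaningful there.
\<close>

definition transition_matrix :: "(real \<Rightarrow> real) \<Rightarrow> real set \<Rightarrow> real set \<Rightarrow> nat" where
  "transition_matrix T i j =
     (if j \<subseteq> T ` i
      then Max {card F |F. finite F \<and>
                  (\<forall>K\<in>F. is_interval K \<and> K \<subseteq> i \<and> monotone_map_on T K \<and> j \<subseteq> T ` K) \<and>
                  pairwise (\<lambda>K L. interior K \<inter> interior L = {}) F}
      else 0)"

text \<open>
  Entries of powers are taken in \<^typ>\<open>ennreal\<close>, so that the possibly infinite sums over the
  index set always have their true value.
\<close>

primrec mat_pow :: "'i set \<Rightarrow> ('i \<Rightarrow> 'i \<Rightarrow> nat) \<Rightarrow> nat \<Rightarrow> 'i \<Rightarrow> 'i \<Rightarrow> ennreal" where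
  "mat_pow P M 0 i j = (if i = j then 1 else 0)"
| "mat_pow P M (Suc n) i j = (\<Sum>\<^sub>\<infinity>k\<in>P. of_nat (M i k) * mat_pow P M n k j)"

text \<open>The real supremum below is a genuine one, since the convergent sequence is bounded.\<close>

definition is_perron_value :: "'i set \<Rightarrow> ('i \<Rightarrow> 'i \<Rightarrow> nat) \<Rightarrow> real \<Rightarrow> bool" where
  "is_perron_value P M L \<longleftrightarrow>
     (\<forall>i\<in>P. \<forall>j\<in>P. \<forall>n. mat_pow P M n i j < \<infinity>) \<and>
     (\<forall>i\<in>P. \<forall>j\<in>P. (\<lambda>n. root n (enn2real (mat_pow P M n i j))) \<longlonglongrightarrow> L) \<and>
     (\<forall>i\<in>P. L = (SUP n\<in>{1..}. root n (enn2real (mat_pow P M n i i))))"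

definition perron_value :: "'i set \<Rightarrow> ('i \<Rightarrow> 'i \<Rightarrow> nat) \<Rightarrow> real" where
  "perron_value P M = (THE L. is_perron_value P M L)"

lemma perron_value_eqI:
  assumes "is_perron_value P M L" "P \<noteq> {}"
  shows "perron_value P M = L"
  unfolding perron_value_def
proof (rule the_equality)
  fix L' assume "is_perron_value P M L'"
  then show "L' = L"
    using assms unfolding is_perron_value_def by (metis ex_in_conv)
qed (fact assms(1))

definition is_lambda_solution ::
  "'i set \<Rightarrow> ('i \<Rightarrow> 'i \<Rightarrow> nat) \<Rightarrow> real \<Rightarrow> ('i \<Rightarrow> real) \<Rightarrow> bool" where
  "is_lambda_solution P M l v \<longleftrightarrow>
     (\<forall>i\<in>P. 0 \<le> v i) \<and> (\<exists>i\<in>P. v i \<noteq> 0) \<and>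
     (\<forall>i\<in>P. ((\<lambda>j. real (M i j) * v j) has_sum (l * v i)) P)"

end

(*
  By the Markov property, for y in the interior of j outside a countable set, the entry of M^n at
  (i, j) is the number of x in i with T^n x = y, each lying in an interval of i that T^n maps
  bijectively onto j.

  Entropy is at least ln lambda: after discarding the at most two branches of T^n from i onto i
  that touch the end points of i, the others form a horseshoe, so (M^n)_ii - 2 <= exp (n h); the 2
  disappears by supermultiplicativity.

  Entropy is at most ln lambda: suppose all entries of M^n are O(theta^n), theta > 1.  Replace T by
  an iterate f = T^p with theta^p >= 6 and cut [0,1] into N equal letters.  An interval meets at
  most five letters beyond those which it contains, so a new itinerary of length n costs either a
  factor 5 per step or a preimage of one of N marked points.  By mixing, a letter away from 0 and 1
  lies in some T^m i, so its preimage counts are entries of powers of M.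

  An l-solution v satisfies (M^n)_ii v_i <= l^n v_i, whence the second claim.
*)
theory Submission imports Defs begin

section \<open>Cardinalities as extended numbers\<close>

text \<open>Two obstacles shape the proof. The partition may be infinite, with cells that
  accumulate, so it offers no finite code for orbits. The upper bound therefore codes orbits by
  equal letters unrelated to T, and the Markov structure enters only through the number of preimages
  of marked points. Moreover, mixing yields eventual covering only of compact subintervals of (0,1),
  since an end point may have no preimage but itself; hence the separate treatment of the letters at
  the ends.

  The countable set to be avoided consists of the forward orbits of all points that are not interior
  to a cell. A point outside it has its whole backward tree in cell interiors, so each preimage
  follows a unique path of cells, and the sum over paths counts it once.

  The five letters are the two extreme ones that the interval meets and the three unmarked ones 0, N
  - 1 and N. The bound 6 is the first integer above 5, which leaves room for a geometric series, and
  it makes the factor 3 paid for the end letters at most half of theta^p.\<close>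

abbreviation ecard :: "'a set \<Rightarrow> ennreal" where
  "ecard A \<equiv> emeasure (count_space UNIV) A"

text \<open>The reason for counting with a measure: fibres of iterates are compared with matrix
  entries before either is known to be finite, and \<open>card\<close> would give 0 on an infinite
  set.\<close>

lemma ecard_infinite: "infinite A \<Longrightarrow> ecard A = \<infinity>"
  by (simp add: emeasure_count_space)

lemma ecard_mono: "A \<subseteq> B \<Longrightarrow> ecard A \<le> ecard B"
  by (rule emeasure_mono) auto

lemma ecard_leI:
  assumes "\<And>S. finite S \<Longrightarrow> S \<subseteq> X \<Longrightarrow> of_nat (card S) \<le> B"
  shows "ecard X \<le> B"
proof (cases "finite X")
  case True
  then show ?thesis using assms[of X] by simp
next
  case False
  have "of_nat n \<le> B" for n
  proof -
    obtain S where "finite S" "card S = n" "S \<subseteq> X"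
      using infinite_arbitrarily_large[OF False] by blast
    then show ?thesis using assms[of S] by simp
  qed
  then have "B = \<infinity>"
    by (metis ennreal_Ex_less_of_nat infinity_ennreal_def leD top.not_eq_extremum)
  then show ?thesis by simp
qed

lemma of_nat_le_ecardE:
  assumes "of_nat N \<le> ecard X"
  obtains S where "finite S" "S \<subseteq> X" "card S = N"
proof (cases "finite X")
  case True
  then have "N \<le> card X" using assms by simp
  then show ?thesis using obtain_subset_with_card_n that True by (metis finite_subset)
next
  case False
  then show ?thesis using infinite_arbitrarily_large that by blast
qed

lemma infsum_ennreal_SUP:
  fixes f :: "'a \<Rightarrow> ennreal"
  shows "infsum f A = (SUP F\<in>{F. finite F \<and> F \<subseteq> A}. sum f F)"
  by (rule nonneg_infsum_complete) simp

lemma sum_le_infsum_ennreal: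
  fixes f :: "'a \<Rightarrow> ennreal"
  assumes "finite F" "F \<subseteq> A"
  shows "sum f F \<le> infsum f A"
  unfolding infsum_ennreal_SUP using assms by (intro SUP_upper) auto

lemma infsum_ennreal_mono:
  fixes f :: "'a \<Rightarrow> ennreal"
  assumes "\<And>x. x \<in> A \<Longrightarrow> f x \<le> g x"
  shows "infsum f A \<le> infsum g A"
  by (rule infsum_mono) (auto intro: assms nonneg_summable_on_complete)

lemma infsum_ennreal_cmult_left:
  fixes f :: "'a \<Rightarrow> ennreal"
  shows "infsum (\<lambda>x. f x * c) A = infsum f A * c"
  unfolding infsum_ennreal_SUP
  by (simp add: sum_distrib_right[symmetric] SUP_mult_right_ennreal)

text \<open>Both sides are suprema over finite pieces: a finite subset of the union meets only
  finitely many of the sets \<open>A k\<close>, and for finitely many sets additivity is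
  available.\<close>

lemma ecard_UN_disjoint:
  assumes "disjoint_family_on A P"
  shows "ecard (\<Union>k\<in>P. A k) = (\<Sum>\<^sub>\<infinity>k\<in>P. ecard (A k))"
proof (rule antisym)
  have *: "(\<Sum>k\<in>F. ecard (A k)) = ecard (\<Union>k\<in>F. A k)" if "finite F" "F \<subseteq> P" for F
    using that disjoint_family_on_mono[OF that(2) assms] by (intro sum_emeasure) auto
  show "(\<Sum>\<^sub>\<infinity>k\<in>P. ecard (A k)) \<le> ecard (\<Union>k\<in>P. A k)"
    unfolding infsum_ennreal_SUP
  proof (rule SUP_least)
    fix F assume "F \<in> {F. finite F \<and> F \<subseteq> P}"
    then show "(\<Sum>k\<in>F. ecard (A k)) \<le> ecard (\<Union>k\<in>P. A k)"
      using *[of F] by (auto intro!: ecard_mono)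
  qed
  show "ecard (\<Union>k\<in>P. A k) \<le> (\<Sum>\<^sub>\<infinity>k\<in>P. ecard (A k))"
  proof (rule ecard_leI)
    fix S assume S: "finite S" "S \<subseteq> (\<Union>k\<in>P. A k)"
    then obtain F where F: "F \<subseteq> P" "finite F" "S \<subseteq> (\<Union>k\<in>F. A k)"
      using finite_subset_Union[of S "A ` P"] by (metis finite_subset_image)
    have "of_nat (card S) = ecard S" using S by simp
    also have "\<dots> \<le> ecard (\<Union>k\<in>F. A k)" using F by (intro ecard_mono)
    also have "\<dots> \<le> (\<Sum>\<^sub>\<infinity>k\<in>P. ecard (A k))"
      using * F sum_le_infsum_ennreal by metis
    finally show "of_nat (card S) \<le> (\<Sum>\<^sub>\<infinity>k\<in>P. ecard (A k))" .
  qed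
qed

text \<open>One application of an m-to-one map multiplies the count by m. For m = 0 and infinite
  \<open>Z\<close> this agrees with the convention 0 * \<infinity> = 0, which is why that case is
  split off.\<close>

lemma ecard_fibres:
  assumes "\<And>z. z \<in> Z \<Longrightarrow> finite {x\<in>X. f x = z} \<and> card {x\<in>X. f x = z} = m"
  shows "ecard {x\<in>X. f x \<in> Z} = of_nat m * ecard Z"
proof (cases "m = 0")
  case True
  then have "{x\<in>X. f x \<in> Z} = {}" using assms by (force simp: card_eq_0_iff)
  then show ?thesis using True by (simp only: emeasure_empty) simp
next
  case False
  show ?thesis
  proof (cases "finite Z")
    case True
    have eq: "{x\<in>X. f x \<in> Z} = (\<Union>z\<in>Z. {x\<in>X. f x = z})" by auto
    have fin: "finite {x\<in>X. f x \<in> Z}" unfolding eq using True assms by blast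
    have "card {x\<in>X. f x \<in> Z} = (\<Sum>z\<in>Z. card {x\<in>X. f x = z})"
      unfolding eq using True assms by (intro card_UN_disjoint) auto
    then have "card {x\<in>X. f x \<in> Z} = m * card Z" using assms by simp
    then show ?thesis using fin True by simp
  next
    case inf: False
    have "Z \<subseteq> f ` {x\<in>X. f x \<in> Z}"
    proof
      fix z assume z: "z \<in> Z"
      then have "{x\<in>X. f x = z} \<noteq> {}" using assms[OF z] \<open>m \<noteq> 0\<close> by (metis card.empty)
      then show "z \<in> f ` {x\<in>X. f x \<in> Z}" using z by auto
    qed
    then have "infinite {x\<in>X. f x \<in> Z}" using inf by (meson finite_imageI finite_subset)
    then show ?thesis using inf \<open>m \<noteq> 0\<close> by (simp add: ecard_infinite ennreal_mult_top)
  qed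
qed

section \<open>Injective continuous maps on intervals\<close>

text \<open>Injectivity and continuity force strict monotonicity, so inner points have images
  strictly between those of the ends; the extreme values c and d are attained and can only come from
  the ends.\<close>

lemma continuous_inj_segment:
  fixes f :: "real \<Rightarrow> real"
  assumes "continuous_on {p..q} f" "inj_on f {p..q}" "f ` {p..q} = {c..d}" "p < q"
  shows continuous_inj_segment_open: "\<And>w. p < w \<Longrightarrow> w < q \<Longrightarrow> c < f w \<and> f w < d"
    and continuous_inj_segment_ends: "f p \<in> {c, d}" "f q \<in> {c, d}"
proof -
  have pq: "f p \<in> {c..d}" "f q \<in> {c..d}" using assms by auto
  show op: "c < f w \<and> f w < d" if "p < w" "w < q" for w
    using continuous_inj_imp_mono[OF that assms(1,2)] pq by auto
  have "f p \<noteq> f q" using assms(2,4) by (auto dest: inj_onD)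
  then have "c < d" using pq by auto
  then have "c \<in> f ` {p..q}" "d \<in> f ` {p..q}" unfolding assms(3) by auto
  then obtain u v where uv: "u \<in> {p..q}" "v \<in> {p..q}" "f u = c" "f v = d" by auto
  then have "u = p \<or> u = q" "v = p \<or> v = q" using op[of u] op[of v] by fastforce+
  then show "f p \<in> {c, d}" "f q \<in> {c, d}" using uv \<open>c < d\<close> by auto
qed

text \<open>Two branches onto the same interval can meet only over its end points. If an end of one
  segment were interior to the other, its image would be strictly between c and d, yet ends are
  mapped to c or d.\<close>

lemma continuous_inj_segments_eq:
  fixes f :: "real \<Rightarrow> real"
  assumes "continuous_on {p..q} f" "inj_on f {p..q}" "f ` {p..q} = {c..d}" "p < q"
    and "continuous_on {p'..q'} f" "inj_on f {p'..q'}" "f ` {p'..q'} = {c..d}" "p' < q'"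
    and u: "u \<in> {p..q}" "u \<in> {p'..q'}" "c < f u" "f u < d"
  shows "p = p' \<and> q = q'"
proof -
  note e1 = continuous_inj_segment_ends[OF assms(1-4)]
  note e2 = continuous_inj_segment_ends[OF assms(5-8)]
  note o1 = continuous_inj_segment_open[OF assms(1-4)]
  note o2 = continuous_inj_segment_open[OF assms(5-8)]
  have "u \<notin> {p,q,p',q'}" using e1 e2 u by auto
  then have b: "p < u" "u < q" "p' < u" "u < q'" using u by auto
  have "p = p'" using o1[of p'] o2[of p] e1 e2 b by (cases p p' rule: linorder_cases) auto
  moreover have "q = q'" using o1[of q'] o2[of q] e1 e2 b by (cases q q' rule: linorder_cases) auto
  ultimately show ?thesis by simp
qed

lemma continuous_inj_segments_overlap_eq:
  fixes f :: "real \<Rightarrow> real"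
  assumes "continuous_on {p..q} f" "inj_on f {p..q}" "f ` {p..q} = {c..d}"
    and "continuous_on {p'..q'} f" "inj_on f {p'..q'}" "f ` {p'..q'} = {c..d}"
    and "max p p' < min q q'"
  shows "p = p' \<and> q = q'"
proof -
  obtain u where "max p p' < u" "u < min q q'" using dense[OF assms(7)] by blast
  then have u: "p < u" "u < q" "p' < u" "u < q'" by auto
  have "c < f u \<and> f u < d"
    using continuous_inj_segment_open[of p q f c d u] assms u by auto
  then show ?thesis
    using u assms by (intro continuous_inj_segments_eq[of p q f c d p' q' u]) auto
qed

text \<open>The segment spanned by preimages of c and d works: the intermediate value theorem gives
  surjectivity, and injectivity keeps the values from leaving the interval.\<close>

lemma inj_interval_segment:
  fixes f :: "real \<Rightarrow> real"
  assumes K: "is_interval K" "continuous_on K f" "inj_on f K" "{c..d} \<subseteq> f ` K" and cd: "c < d"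
  obtains p q where "p < q" "{p..q} \<subseteq> K" "f ` {p..q} = {c..d}"
proof -
  have "c \<in> f ` K" "d \<in> f ` K" using K(4) cd by auto
  then obtain u v where uv: "u \<in> K" "v \<in> K" "f u = c" "f v = d" by auto
  define p q where "p = min u v" and "q = max u v"
  have pq: "p < q" using uv cd by (cases u v rule: linorder_cases) (auto simp: p_def q_def)
  have sub: "{p..q} \<subseteq> K"
    using uv K(1) connected_contains_Icc[of K p q]
    by (simp add: is_interval_connected_1 p_def q_def min_def max_def)
  have cont: "continuous_on {p..q} f" using K(2) sub by (rule continuous_on_subset)
  have inj: "inj_on f {p..q}" using K(3) sub by (rule inj_on_subset)
  have conn: "connected (f ` {p..q})" using cont by (intro connected_continuous_image) auto
  have "c \<in> f ` {p..q}" "d \<in> f ` {p..q}"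
    using uv unfolding p_def q_def by (auto simp: min_def max_def)
  then have "{c..d} \<subseteq> f ` {p..q}" using conn connected_contains_Icc by blast
  moreover have "f w \<in> {c..d}" if "w \<in> {p..q}" for w
  proof (cases "w \<in> {p,q}")
    case True
    then show ?thesis using uv cd unfolding p_def q_def by (auto simp: min_def max_def split: if_splits)
  next
    case False
    then have "p < w" "w < q" using that by auto
    from continuous_inj_imp_mono[OF this cont inj] show ?thesis
      using uv cd unfolding p_def q_def by (auto simp: min_def max_def split: if_splits)
  qed
  ultimately show ?thesis using that pq sub by blast
qed

text \<open>The Markov property speaks of maximal intervals only; Zorn's lemma supplies one through
  each point.\<close>

lemma maximal_monotone_interval_exists:
  fixes T :: "real \<Rightarrow> real"
  assumes "x \<in> i"
  obtains K where "maximal_monotone_interval T i K" "x \<in> K"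
proof -
  define A where "A = {K. is_interval K \<and> K \<subseteq> i \<and> monotone_map_on T K \<and> x \<in> K}"
  have "\<exists>M\<in>A. \<forall>X\<in>A. M \<subseteq> X \<longrightarrow> X = M"
  proof (rule subset_Zorn_nonempty)
    have "{x} \<in> A"
      using assms by (auto simp: A_def monotone_map_on_def monotone_on_def is_interval_1)
    then show "A \<noteq> {}" by blast
    fix C assume C: "C \<noteq> {}" "subset.chain A C"
    then have CA: "C \<subseteq> A" and tot: "\<And>K L. K \<in> C \<Longrightarrow> L \<in> C \<Longrightarrow> K \<subseteq> L \<or> L \<subseteq> K"
      by (auto simp: subset.chain_def)
    have "is_interval (\<Union>C)"
      unfolding is_interval_connected_1
      using CA by (intro connected_Union) (auto simp: A_def is_interval_connected_1)
    moreover have "monotone_map_on T (\<Union>C)"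
    proof (cases "\<forall>K\<in>C. mono_on K T")
      case True
      have "mono_on (\<Union>C) T"
      proof (rule mono_onI)
        fix r s assume "r \<in> \<Union>C" "s \<in> \<Union>C" "r \<le> s"
        then obtain K L where KL: "K \<in> C" "r \<in> K" "L \<in> C" "s \<in> L" by blast
        then obtain N where "N \<in> C" "r \<in> N" "s \<in> N" using tot[OF KL(1,3)] by blast
        then show "T r \<le> T s" using True \<open>r \<le> s\<close> by (meson mono_onD)
      qed
      then show ?thesis by (simp add: monotone_map_on_def)
    next
      case False
      \<comment> \<open>One member that is not increasing settles the direction: every larger member
        of the chain must be decreasing, and enlarging by \<open>K0\<close> costs nothing in a
        chain.\<close>
      then obtain K0 where K0: "K0 \<in> C" "\<not> mono_on K0 T" by blast
      have anti: "antimono_on K T" if "K \<in> C" "K0 \<subseteq> K" for K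
      proof -
        have "monotone_map_on T K" using that CA by (auto simp: A_def)
        moreover have "\<not> mono_on K T" using that K0 mono_on_subset by blast
        ultimately show ?thesis by (simp add: monotone_map_on_def)
      qed
      have "antimono_on (\<Union>C) T"
      proof (rule monotone_onI)
        fix r s assume "r \<in> \<Union>C" "s \<in> \<Union>C" "r \<le> s"
        then obtain K L where KL: "K \<in> C" "r \<in> K" "L \<in> C" "s \<in> L" by blast
        define N where "N = K0 \<union> K \<union> L"
        have "N \<in> {K0, K, L}" using tot[OF K0(1) KL(1)] tot[OF K0(1) KL(3)] tot[OF KL(1,3)]
          unfolding N_def by blast
        then have "N \<in> C" "K0 \<subseteq> N" "r \<in> N" "s \<in> N" using K0 KL by (auto simp: N_def)
        then show "T s \<le> T r" using anti \<open>r \<le> s\<close> by (meson monotone_onD)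
      qed
      then show ?thesis by (simp add: monotone_map_on_def)
    qed
    ultimately show "\<Union>C \<in> A" using CA C(1) by (auto simp: A_def)
  qed
  then obtain M where M: "M \<in> A" "\<And>X. X \<in> A \<Longrightarrow> M \<subseteq> X \<Longrightarrow> X = M" by blast
  then have "maximal_monotone_interval T i M" unfolding maximal_monotone_interval_def A_def by blast
  then show ?thesis using that M by (auto simp: A_def)
qed

section \<open>Branches of a mixing Markov map\<close>

locale markov_map =
  fixes T :: "real \<Rightarrow> real" and P :: "real set set"
  assumes continuous: "continuous_on {0..1} T"
    and maps_into: "T ` {0..1} \<subseteq> {0..1}"
    and mixing: "topologically_mixing_on {0..1} T"
    and markov: "markov_partition T P"
begin

lemma countable_partition: "countable P"
  and cell_closed_interval: "\<forall>i\<in>P. \<exists>a b. 0 \<le> a \<and> a < b \<and> b \<le> 1 \<and> i = {a..b}"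
  and disjoint_interiors: "pairwise (\<lambda>i j. interior i \<inter> interior j = {}) P"
  and countable_uncovered: "countable ({0..1} - \<Union>P)"
  and classical_or_slack: "classical_on T P \<or> slack_on T P"
  and markov_property: "\<forall>i\<in>P. \<forall>j\<in>P. \<forall>K. maximal_monotone_interval T i K \<longrightarrow>
        T ` K \<inter> interior j \<noteq> {} \<longrightarrow> j \<subseteq> T ` K"
  using markov unfolding markov_partition_def by - (elim conjE, assumption)+

lemma cellE:
  assumes "i \<in> P"
  obtains a b where "0 \<le> a" "a < b" "b \<le> 1" "i = {a..b}"
  using bspec[OF cell_closed_interval assms] by blast

lemma cell_subset: "i \<in> P \<Longrightarrow> i \<subseteq> {0..1}"
  by (erule cellE) auto

text \<open>A cell is the closure of its interior, so an open set that touches the cell also meets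
  its interior.\<close>

lemma cells_eqI:
  assumes "i \<in> P" "j \<in> P" "x \<in> i" "x \<in> interior j"
  shows "i = j"
proof (rule ccontr)
  assume "i \<noteq> j"
  then have dis: "interior i \<inter> interior j = {}"
    using disjoint_interiors assms by (auto dest: pairwiseD)
  obtain a b where i: "0 \<le> a" "a < b" "b \<le> 1" "i = {a..b}" using cellE assms(1) .
  then have "i = closure (interior i)" by simp
  then have "interior i \<inter> interior j \<noteq> {}"
    using assms by (metis disjoint_iff open_Int_closure_eq_empty open_interior)
  then show False using dis by simp
qed

lemma funpow_in: "x \<in> {0..1} \<Longrightarrow> (T ^^ n) x \<in> {0..1}"
  using maps_into by (induction n) (auto simp: image_subset_iff)

lemma funpow_continuous: "continuous_on {0..1} (T ^^ n)"
proof (induction n)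
  case (Suc n)
  have "continuous_on ((T ^^ n) ` {0..1}) T"
    using continuous funpow_in by (rule_tac continuous_on_subset) auto
  then show ?case using continuous_on_compose[OF Suc] by simp
qed (simp add: id_def)

text \<open>Mixing sends some point of the interval to the left of c and another to the right of d
  at every late time; the image is connected and fills the gap.\<close>

lemma eventually_covers:
  assumes "0 \<le> a" "a < b" "b \<le> 1" "0 < c" "d < 1"
  obtains n where "\<And>m. n \<le> m \<Longrightarrow> {c..d} \<subseteq> (T ^^ m) ` {a..b}"
proof -
  define U where "U = {0..1} \<inter> {a<..<b}"
  define c' d' where "c' = min c 1" and "d' = max d 0"
  have open_part: "openin (top_of_set {0..1}) ({0..1} \<inter> S)" "{0..1} \<inter> S \<noteq> {}"
    if "open S" "x \<in> {0..1}" "x \<in> S" for S :: "real set" and x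
  proof -
    show "openin (top_of_set {0..1}) ({0..1} \<inter> S)" using that(1) by (rule openin_open_Int)
    show "{0..1} \<inter> S \<noteq> {}" using that(2,3) by blast
  qed
  have "(a + b) / 2 \<in> {0..1}" "(a + b) / 2 \<in> {a<..<b}" using assms by auto
  note U = open_part[OF open_greaterThanLessThan this, folded U_def]
  have "0 \<in> {0..1::real}" "0 \<in> {..<c'}" using assms by (auto simp: c'_def)
  note V = open_part[OF open_lessThan this]
  have "1 \<in> {0..1::real}" "1 \<in> {d'<..}" using assms by (auto simp: d'_def)
  note W = open_part[OF open_greaterThan this]
  obtain n1 where n1: "\<And>m. n1 \<le> m \<Longrightarrow> (T ^^ m) ` U \<inter> ({0..1} \<inter> {..<c'}) \<noteq> {}"
    using mixing U V unfolding topologically_mixing_on_def by metis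
  obtain n2 where n2: "\<And>m. n2 \<le> m \<Longrightarrow> (T ^^ m) ` U \<inter> ({0..1} \<inter> {d'<..}) \<noteq> {}"
    using mixing U W unfolding topologically_mixing_on_def by metis
  have "{c..d} \<subseteq> (T ^^ m) ` {a..b}" if m: "max n1 n2 \<le> m" for m
  proof -
    obtain u where u: "u \<in> U" "(T ^^ m) u < c" using n1[of m] m by (auto simp: c'_def)
    obtain v where v: "v \<in> U" "d < (T ^^ m) v" using n2[of m] m by (auto simp: d'_def)
    have "connected ((T ^^ m) ` {a..b})"
      using assms by (intro connected_continuous_image continuous_on_subset[OF funpow_continuous]) auto
    moreover have "(T ^^ m) u \<in> (T ^^ m) ` {a..b}" "(T ^^ m) v \<in> (T ^^ m) ` {a..b}"
      using u v by (auto simp: U_def)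
    ultimately have "{(T ^^ m) u..(T ^^ m) v} \<subseteq> (T ^^ m) ` {a..b}"
      using connected_contains_Icc by blast
    moreover have "{c..d} \<subseteq> {(T ^^ m) u..(T ^^ m) v}" using u v by auto
    ultimately show ?thesis by (rule order_trans[rotated])
  qed
  then show ?thesis using that by blast
qed

text \<open>Weak monotonicity becomes strict: a monotone map with two equal values is constant
  between them, so all later images of that segment are single points, whereas by mixing they must
  cover [1/3, 2/3].\<close>

lemma monotone_imp_inj:
  assumes K: "is_interval K" "K \<subseteq> {0..1}" "monotone_map_on T K"
  shows "inj_on T K"
proof (rule linorder_inj_onI')
  fix x y assume xy: "x \<in> K" "y \<in> K" "x < y"
  show "T x \<noteq> T y"
  proof
    assume eq: "T x = T y"
    have sub: "{x..y} \<subseteq> K"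
      using K(1) xy connected_contains_Icc is_interval_connected_1 by blast
    have const: "T z = T x" if "z \<in> {x..y}" for z
    proof -
      have z: "z \<in> K" "x \<le> z" "z \<le> y" using sub that by auto
      from K(3) show ?thesis
        unfolding monotone_map_on_def
      proof
        assume m: "mono_on K T"
        then show ?thesis using mono_onD[OF m xy(1) z(1,2)] mono_onD[OF m z(1) xy(2) z(3)] eq by simp
      next
        assume m: "antimono_on K T"
        then show ?thesis using monotone_onD[OF m xy(1) z(1,2)] monotone_onD[OF m z(1) xy(2) z(3)] eq by simp
      qed
    qed
    have "0 \<le> x" "y \<le> 1" using xy K(2) by auto
    then obtain n where n: "\<And>m. n \<le> m \<Longrightarrow> {1/3..2/3} \<subseteq> (T ^^ m) ` {x..y}"
      using eventually_covers[of x y "1/3" "2/3"] xy(3) by auto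
    have "(T ^^ Suc n) z = (T ^^ Suc n) x" if "z \<in> {x..y}" for z
      using const[OF that] by (simp add: funpow_swap1)
    then have "(T ^^ Suc n) ` {x..y} \<subseteq> {(T ^^ Suc n) x}" by blast
    then have "{1/3..2/3} \<subseteq> {(T ^^ Suc n) x}" using n[of "Suc n"] by simp
    from subsetD[OF this, of "1/3"] subsetD[OF this, of "2/3"] show False by simp
  qed
qed

text \<open>The lap of T through x covers all of j by the Markov property and can be cut down to the
  part above [c,d], which contains x because T is injective on the lap. A subinterval of j is
  allowed as target so that branches of iterates can be pulled back step by step.\<close>

lemma lap_segment:
  assumes "i \<in> P" "j \<in> P" "x \<in> i" "T x \<in> interior j" "{c..d} \<subseteq> j" "c < d" "T x \<in> {c..d}"
  obtains p q where "p < q" "{p..q} \<subseteq> i" "x \<in> {p..q}" "inj_on T {p..q}" "T ` {p..q} = {c..d}"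
    "monotone_map_on T {p..q}"
proof -
  obtain K where K: "maximal_monotone_interval T i K" "x \<in> K"
    using maximal_monotone_interval_exists assms(3) .
  then have K': "is_interval K" "K \<subseteq> i" "monotone_map_on T K"
    by (auto simp: maximal_monotone_interval_def)
  have "T ` K \<inter> interior j \<noteq> {}" using K assms by blast
  then have "j \<subseteq> T ` K" using bspec[OF bspec[OF markov_property assms(1)] assms(2)] K(1) by blast
  then have cov: "{c..d} \<subseteq> T ` K" using assms by blast
  have K01: "K \<subseteq> {0..1}" using K' cell_subset assms by blast
  have inj: "inj_on T K" using monotone_imp_inj K' K01 by blast
  obtain p q where pq: "p < q" "{p..q} \<subseteq> K" "T ` {p..q} = {c..d}"
    using inj_interval_segment[OF K'(1) continuous_on_subset[OF continuous K01] inj cov assms(6)] .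
  have "x \<in> {p..q}"
    using pq K(2) assms(7) inj by (metis (no_types, lifting) imageE inj_onD subsetD)
  moreover have "monotone_map_on T {p..q}"
    using K'(3) pq(2) monotone_on_subset unfolding monotone_map_on_def by blast
  ultimately show ?thesis using that pq inj K'(2) by (meson inj_on_subset order_trans)
qed

text \<open>Each of the finitely many monotone pieces of the cell carries at most one solution;
  their number bounds all fibres at once.\<close>

lemma finite_fibre:
  assumes "i \<in> P"
  obtains B where "\<And>y. finite {x\<in>i. T x = y} \<and> card {x\<in>i. T x = y} \<le> B"
proof -
  obtain a b where i: "0 \<le> a" "a < b" "b \<le> 1" "i = {a..b}" using cellE assms .
  have "\<exists>D. D division_of i \<and> (\<forall>K\<in>D. monotone_map_on T K)"
  proof (cases "monotone_map_on T i")
    case True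
    have "{i} division_of i" unfolding i using i by (intro division_of_self[where 'a=real, simplified]) auto
    then show ?thesis using True by blast
  next
    case False
    then show ?thesis
      using classical_or_slack assms unfolding classical_on_def slack_on_def
        piecewise_monotone_on_def by blast
  qed
  then obtain D where D: "D division_of i" "\<And>K. K \<in> D \<Longrightarrow> monotone_map_on T K" by blast
  have "finite {x\<in>i. T x = y} \<and> card {x\<in>i. T x = y} \<le> card D" for y
  proof -
    have one: "finite {x\<in>K. T x = y} \<and> card {x\<in>K. T x = y} \<le> 1" if K: "K \<in> D" for K
    proof -
      have "is_interval K" "K \<subseteq> {0..1}"
        using D(1) K cell_subset[OF assms] division_ofD(2,4)[OF D(1) K] by (auto intro: is_interval_cbox)
      then have "inj_on T K" using monotone_imp_inj D(2)[OF K] by blast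
      then have "{x\<in>K. T x = y} \<subseteq> {the_inv_into K T y}" by (auto simp: the_inv_into_f_f)
      then show ?thesis using card_mono[of "{the_inv_into K T y}"] by (auto dest: finite_subset)
    qed
    have finD: "finite D" using D(1) by blast
    have eq: "{x\<in>i. T x = y} = (\<Union>K\<in>D. {x\<in>K. T x = y})"
      using division_ofD(6)[OF D(1)] by blast
    have "card {x\<in>i. T x = y} \<le> (\<Sum>K\<in>D. card {x\<in>K. T x = y})"
      unfolding eq using finD by (rule card_UN_le)
    also have "\<dots> \<le> (\<Sum>K\<in>D. 1)" using one by (intro sum_mono) auto
    finally show ?thesis using one finD eq by auto
  qed
  then show ?thesis using that by blast
qed

text \<open>
  Every element of an admissible family contains exactly one solution of \<open>T x = y\<close> in its
  interior, and conversely every solution lies in a lap, which covers \<open>j\<close> by the Markov property.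
\<close>

lemma transition_matrix_eq_card:
  assumes ij: "i \<in> P" "j \<in> P" and y: "y \<in> interior j"
  shows "transition_matrix T i j = card {x\<in>i. T x = y}"
proof -
  define S where "S = {x\<in>i. T x = y}"
  have finS: "finite S" using finite_fibre[OF ij(1)] unfolding S_def by blast
  obtain c d where j: "0 \<le> c" "c < d" "d \<le> 1" "j = {c..d}" using cellE ij(2) .
  have ycd: "c < y" "y < d" using y j by auto
  have "\<exists>p q. p < q \<and> {p..q} \<subseteq> i \<and> x \<in> {p..q} \<and> inj_on T {p..q} \<and> T ` {p..q} = {c..d} \<and>
      monotone_map_on T {p..q}" if "x \<in> S" for x
    using lap_segment[OF ij, of x c d] that y j ycd unfolding S_def by (simp) metis
  then obtain p q where pq: "\<And>x. x \<in> S \<Longrightarrow> p x < q x \<and> {p x..q x} \<subseteq> i \<and> x \<in> {p x..q x} \<and>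
      inj_on T {p x..q x} \<and> T ` {p x..q x} = {c..d} \<and> monotone_map_on T {p x..q x}"
    by metis
  have cont: "continuous_on {p x..q x} T" if "x \<in> S" for x
    using pq[OF that] cell_subset[OF ij(1)] by (meson continuous continuous_on_subset order_trans)
  \<comment> \<open>Overlapping segments coincide, and then T is injective on the common segment
    while x and x' have the same image y.\<close>
  have same: "x = x'" if x: "x \<in> S" "x' \<in> S" and m: "interior {p x..q x} \<inter> interior {p x'..q x'} \<noteq> {}" for x x'
  proof -
    have "max (p x) (p x') < min (q x) (q x')" using m by (auto simp: not_le)
    then have "p x = p x' \<and> q x = q x'"
      using pq[OF x(1)] pq[OF x(2)]
      by (intro continuous_inj_segments_overlap_eq[where f = T and c = c and d = d] cont x) simp_all
    then show ?thesis using pq[OF x(1)] pq[OF x(2)] x unfolding S_def by (auto dest: inj_onD)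
  qed
  show ?thesis
  proof (cases "j \<subseteq> T ` i")
    case False
    have "S = {}"
    proof (rule ccontr)
      assume "S \<noteq> {}"
      then obtain x where "x \<in> S" by blast
      then show False using pq[of x] False j by blast
    qed
    then show ?thesis using False unfolding transition_matrix_def S_def[symmetric] by simp
  next
    case True
    define C where "C = {card F |F. finite F \<and>
                  (\<forall>K\<in>F. is_interval K \<and> K \<subseteq> i \<and> monotone_map_on T K \<and> j \<subseteq> T ` K) \<and>
                  pairwise (\<lambda>K L. interior K \<inter> interior L = {}) F}"
    have up: "n \<le> card S" if "n \<in> C" for n
    proof -
      obtain F where F: "n = card F" "finite F"
        "\<And>K. K \<in> F \<Longrightarrow> is_interval K \<and> K \<subseteq> i \<and> monotone_map_on T K \<and> j \<subseteq> T ` K"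
        "pairwise (\<lambda>K L. interior K \<inter> interior L = {}) F"
        using \<open>n \<in> C\<close> unfolding C_def by blast
      have "\<exists>x\<in>S. x \<in> interior K" if "K \<in> F" for K
      proof -
        have K: "is_interval K" "K \<subseteq> i" "monotone_map_on T K" "{c..d} \<subseteq> T ` K"
          using F(3)[OF \<open>K \<in> F\<close>] j by auto
        have K01: "K \<subseteq> {0..1}" using K cell_subset[OF ij(1)] by blast
        obtain u v where uv: "u < v" "{u..v} \<subseteq> K" "T ` {u..v} = {c..d}"
          using inj_interval_segment[OF K(1) continuous_on_subset[OF continuous K01]
              monotone_imp_inj[OF K(1) K01 K(3)] K(4) j(2)] .
        have "y \<in> T ` {u..v}" using uv ycd by simp
        then obtain x where x: "x \<in> {u..v}" "T x = y" by blast
        have cuv: "continuous_on {u..v} T" "inj_on T {u..v}"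
          using continuous_on_subset[OF continuous] uv K01 inj_on_subset[OF monotone_imp_inj[OF K(1) K01 K(3)]] by blast+
        \<comment> \<open>Here y must be interior to j: only then is the solution interior to the
          element of the family, and only interiors are disjoint.\<close>
        have "x \<noteq> u" "x \<noteq> v" using continuous_inj_segment_ends[OF cuv uv(3,1)] ycd x by auto
        then have "x \<in> interior {u..v}" using x by simp
        then have "x \<in> interior K" using interior_mono[OF uv(2)] by blast
        moreover have "x \<in> S" using x uv K unfolding S_def by auto
        ultimately show ?thesis by blast
      qed
      then obtain g where g: "\<And>K. K \<in> F \<Longrightarrow> g K \<in> S \<and> g K \<in> interior K" by metis
      have "inj_on g F"
        using F(4) g unfolding pairwise_def inj_on_def by (metis disjoint_iff)
      then show ?thesis using g finS F(1) by (auto intro: card_inj_on_le)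
    qed
    have "card S \<in> C"
    proof -
      define F where "F = (\<lambda>x. {p x..q x}) ` S"
      have inj: "inj_on (\<lambda>x. {p x..q x}) S"
      proof (rule inj_onI)
        fix x x' assume x: "x \<in> S" "x' \<in> S" "{p x..q x} = {p x'..q x'}"
        have "interior {p x..q x} \<noteq> {}" using pq[OF x(1)] by simp
        then show "x = x'" using x by (intro same) auto
      qed
      have "pairwise (\<lambda>K L. interior K \<inter> interior L = {}) F"
        unfolding pairwise_def F_def using same by blast
      moreover have "\<forall>K\<in>F. is_interval K \<and> K \<subseteq> i \<and> monotone_map_on T K \<and> j \<subseteq> T ` K"
        using pq j unfolding F_def by (auto simp: is_interval_cc)
      moreover have "finite F" "card F = card S"
        using finS inj by (auto simp: F_def card_image)
      ultimately show ?thesis unfolding C_def by (intro CollectI exI[of _ F] conjI) auto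
    qed
    \<comment> \<open>\<open>Max\<close> has its intended meaning only on a finite set.\<close>
    moreover have "finite C" using up by (meson bounded_nat_set_is_finite le_imp_less_Suc)
    ultimately have "Max C = card S" using up by (intro Max_eqI) auto
    then show ?thesis using True unfolding transition_matrix_def C_def S_def by simp
  qed
qed

end

section \<open>Counting preimages\<close>

context markov_map
begin

lemma maps_in: "x \<in> {0..1} \<Longrightarrow> T x \<in> {0..1}"
  using funpow_in[of x 1] by simp

text \<open>If y is outside this set, then every point that some iterate of T sends to y lies in the
  interior of a cell. The set is countable, so such y exist in every nondegenerate interval.\<close>

definition exceptional :: "real set" where
  "exceptional = (\<Union>n. (T ^^ n) ` ({0..1} - (\<Union>k\<in>P. interior k)))"

lemma countable_exceptional: "countable exceptional"
proof -
  have "{0..1} - (\<Union>k\<in>P. interior k) \<subseteq> ({0..1} - \<Union>P) \<union> (\<Union>k\<in>P. k - interior k)" by blast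
  moreover have "countable (k - interior k)" if k: "k \<in> P" for k
  proof -
    obtain a b where "0 \<le> a" "a < b" "b \<le> 1" "k = {a..b}" using cellE k .
    then have "k - interior k \<subseteq> {a, b}" by auto
    then show ?thesis by (meson countable_finite finite.intros finite_subset)
  qed
  ultimately have "countable ({0..1} - (\<Union>k\<in>P. interior k))"
    using countable_uncovered countable_partition by (meson countable_UN countable_Un countable_subset)
  then show ?thesis unfolding exceptional_def by blast
qed

lemma generic_point_exists:
  assumes "c < d"
  obtains y where "c < y" "y < d" "y \<notin> exceptional"
proof -
  have "\<not> {c<..<d} \<subseteq> exceptional"
    using uncountable_open_interval[of c d] assms countable_exceptional by (metis countable_subset)
  then show ?thesis using that by (auto simp: subset_iff)
qed

lemma generic_preimage_in_cell:
  assumes "x \<in> {0..1}" "(T ^^ n) x \<notin> exceptional"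
  obtains k where "k \<in> P" "x \<in> interior k"
  using assms unfolding exceptional_def by blast

text \<open>Preimages under T^(n+1) are sorted by the cell that contains T x. Genericity of y puts T
  x in the interior of exactly one cell k, and over such a point T has as many preimages in i as the
  matrix entry at (i, k).\<close>

lemma mat_pow_eq_ecard:
  assumes "i \<in> P" "j \<in> P" "y \<in> interior j" "y \<notin> exceptional"
  shows "mat_pow P (transition_matrix T) n i j = ecard {x\<in>i. (T ^^ n) x = y}"
  using assms(1)
proof (induction n arbitrary: i)
  case 0
  have "{x\<in>i. x = y} = (if i = j then {y} else {})"
    using cells_eqI[of i j y] 0 assms interior_subset[of j] by auto
  then show ?case by (simp split: if_splits)
next
  case (Suc n)
  define Z where "Z k = {z\<in>k. (T ^^ n) z = y}" for k
  have Z_int: "z \<in> interior k" if "k \<in> P" "z \<in> Z k" for k z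
  proof -
    have z: "z \<in> {0..1}" "(T ^^ n) z \<notin> exceptional"
      using that(2) subsetD[OF cell_subset[OF that(1)], of z] assms(4) unfolding Z_def by auto
    obtain k' where "k' \<in> P" "z \<in> interior k'" using generic_preimage_in_cell z .
    then show ?thesis using cells_eqI[of k k' z] that unfolding Z_def by auto
  qed
  have "{x\<in>i. (T ^^ Suc n) x = y} = (\<Union>k\<in>P. {x\<in>i. T x \<in> Z k})"
  proof (intro equalityI subsetI)
    fix x assume x: "x \<in> {x\<in>i. (T ^^ Suc n) x = y}"
    then have "T x \<in> {0..1}" "(T ^^ n) (T x) \<notin> exceptional"
      using subsetD[OF cell_subset[OF Suc.prems], of x] maps_in[of x] assms(4)
      by (auto simp: funpow_swap1)
    then obtain k where "k \<in> P" "T x \<in> interior k" using generic_preimage_in_cell by blast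
    then show "x \<in> (\<Union>k\<in>P. {x\<in>i. T x \<in> Z k})"
      using x interior_subset[of k] unfolding Z_def by (auto simp: funpow_swap1)
  qed (auto simp: Z_def funpow_swap1)
  then have "ecard {x\<in>i. (T ^^ Suc n) x = y} = ecard (\<Union>k\<in>P. {x\<in>i. T x \<in> Z k})" by simp
  also have "\<dots> = (\<Sum>\<^sub>\<infinity>k\<in>P. ecard {x\<in>i. T x \<in> Z k})"
  proof (rule ecard_UN_disjoint)
    show "disjoint_family_on (\<lambda>k. {x\<in>i. T x \<in> Z k}) P"
      unfolding disjoint_family_on_def
    proof (intro ballI impI)
      fix k l assume kl: "k \<in> P" "l \<in> P" "k \<noteq> l"
      show "{x\<in>i. T x \<in> Z k} \<inter> {x\<in>i. T x \<in> Z l} = {}"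
      proof (rule ccontr)
        assume "{x\<in>i. T x \<in> Z k} \<inter> {x\<in>i. T x \<in> Z l} \<noteq> {}"
        then obtain x where "T x \<in> Z k" "T x \<in> Z l" by blast
        then show False using cells_eqI[of k l "T x"] kl Z_int[of l "T x"] by (auto simp: Z_def)
      qed
    qed
  qed
  also have "\<dots> = (\<Sum>\<^sub>\<infinity>k\<in>P. of_nat (transition_matrix T i k) * mat_pow P (transition_matrix T) n k j)"
  proof (rule infsum_cong)
    fix k assume k: "k \<in> P"
    have "finite {x\<in>i. T x = z} \<and> card {x\<in>i. T x = z} = transition_matrix T i k" if "z \<in> Z k" for z
      using finite_fibre[OF Suc.prems] transition_matrix_eq_card[OF Suc.prems k Z_int[OF k that]] by metis
    then have "ecard {x\<in>i. T x \<in> Z k} = of_nat (transition_matrix T i k) * ecard (Z k)"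
      by (rule ecard_fibres)
    then show "ecard {x\<in>i. T x \<in> Z k} =
        of_nat (transition_matrix T i k) * mat_pow P (transition_matrix T) n k j"
      using Suc.IH[OF k] by (simp add: Z_def)
  qed
  finally show ?case by simp
qed

text \<open>Induction peels off the first application of T: the segment around T x that T^n maps
  onto j is pulled back along the lap of T through x.\<close>

lemma branch_exists:
  assumes "i \<in> P" "j \<in> P" "y \<in> interior j" "y \<notin> exceptional" "x \<in> i" "(T ^^ n) x = y"
  shows "\<exists>p q. p < q \<and> {p..q} \<subseteq> i \<and> x \<in> {p..q} \<and> inj_on (T ^^ n) {p..q} \<and> (T ^^ n) ` {p..q} = j"
  using assms(1,5,6)
proof (induction n arbitrary: i x)
  case 0
  then have "i = j" using cells_eqI[of i j y] assms by auto
  moreover obtain a b where "0 \<le> a" "a < b" "b \<le> 1" "i = {a..b}" using cellE 0(1) .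
  ultimately show ?case using 0 by (intro exI[of _ a] exI[of _ b]) auto
next
  case (Suc n)
  have x01: "x \<in> {0..1}" using Suc.prems cell_subset by blast
  have Tx: "T x \<in> {0..1}" "(T ^^ n) (T x) = y"
    using maps_in[OF x01] Suc.prems(3) by (simp_all add: funpow_swap1)
  then obtain k where k: "k \<in> P" "T x \<in> interior k"
    using generic_preimage_in_cell[of "T x" n] assms(4) by blast
  obtain p q where pq: "p < q" "{p..q} \<subseteq> k" "T x \<in> {p..q}" "inj_on (T ^^ n) {p..q}" "(T ^^ n) ` {p..q} = j"
    using Suc.IH[OF k(1) _ Tx(2)] k(2) interior_subset by blast
  obtain p' q' where pq': "p' < q'" "{p'..q'} \<subseteq> i" "x \<in> {p'..q'}" "inj_on T {p'..q'}" "T ` {p'..q'} = {p..q}"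
    using lap_segment[OF Suc.prems(1) k(1) Suc.prems(2) k(2) pq(2,1,3)] .
  have "inj_on ((T ^^ n) \<circ> T) {p'..q'}" using pq pq' by (intro comp_inj_on) simp_all
  moreover have "((T ^^ n) \<circ> T) ` {p'..q'} = j" using pq pq' by (metis image_comp)
  ultimately show ?case using pq' unfolding funpow_Suc_right by blast
qed

text \<open>Irreducibility and aperiodicity in one: by mixing, T^m i contains a fixed generic point
  of j for all large m. The degenerate interval {y..y} suffices as target.\<close>

lemma mat_pow_eventually_ge_1:
  assumes "i \<in> P" "j \<in> P"
  obtains n where "\<And>m. n \<le> m \<Longrightarrow> 1 \<le> mat_pow P (transition_matrix T) m i j"
proof -
  obtain a b where i: "0 \<le> a" "a < b" "b \<le> 1" "i = {a..b}" using cellE assms(1) .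
  obtain c d where j: "0 \<le> c" "c < d" "d \<le> 1" "j = {c..d}" using cellE assms(2) .
  obtain y where y: "c < y" "y < d" "y \<notin> exceptional" using generic_point_exists j(2) .
  obtain n where n: "\<And>m. n \<le> m \<Longrightarrow> {y..y} \<subseteq> (T ^^ m) ` {a..b}"
    using eventually_covers[OF i(1-3), of y y] y j by auto
  have "1 \<le> mat_pow P (transition_matrix T) m i j" if "n \<le> m" for m
  proof -
    have "y \<in> (T ^^ m) ` i" using n[OF that] i by simp
    then obtain x where "{x} \<subseteq> {x\<in>i. (T ^^ m) x = y}" by blast
    then have "ecard {x} \<le> ecard {x\<in>i. (T ^^ m) x = y}" by (rule ecard_mono)
    then show ?thesis using mat_pow_eq_ecard[OF assms _ y(3)] y j by simp
  qed
  then show ?thesis using that by blast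
qed

end

text \<open>Only the paths that are in state k at time n are kept.\<close>

lemma mat_pow_add_ge:
  assumes "k \<in> P"
  shows "mat_pow P M n i k * mat_pow P M m k j \<le> mat_pow P M (n + m) i j"
proof (induction n arbitrary: i)
  case (Suc n)
  have "mat_pow P M (Suc n) i k * mat_pow P M m k j =
      (\<Sum>\<^sub>\<infinity>l\<in>P. of_nat (M i l) * mat_pow P M n l k * mat_pow P M m k j)"
    by (simp add: infsum_ennreal_cmult_left)
  also have "\<dots> \<le> (\<Sum>\<^sub>\<infinity>l\<in>P. of_nat (M i l) * mat_pow P M (n + m) l j)"
    using Suc by (intro infsum_ennreal_mono) (auto simp: mult.assoc intro: mult_left_mono)
  finally show ?case by simp
qed simp

lemma mat_pow_power_le:
  assumes "i \<in> P"
  shows "mat_pow P M n i i ^ m \<le> mat_pow P M (n * m) i i"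
proof (induction m)
  case (Suc m)
  have "mat_pow P M n i i ^ Suc m \<le> mat_pow P M n i i * mat_pow P M (n * m) i i"
    using Suc by (simp add: mult_left_mono)
  also have "\<dots> \<le> mat_pow P M (n * Suc m) i i"
    using mat_pow_add_ge[OF assms, of M n i "n * m" i] by simp
  finally show ?case .
qed simp

section \<open>Horseshoes and entropy\<close>

text \<open>Every word of length m over \<open>S\<close> is realised by a point obtained from
  successive inverse branches. Different words give points that lie in different sets
  \<open>A s\<close> at some time, hence at a uniform distance, so there are (card S)^m separated
  points for time n * m.\<close>

lemma top_entropy_horseshoe:
  fixes T :: "'a::heine_borel \<Rightarrow> 'a"
  assumes S: "finite S" "S \<noteq> {}" and Y: "Y \<noteq> {}" "Y \<subseteq> X" and n: "0 < n"
    and A: "\<And>s. s \<in> S \<Longrightarrow> compact (A s) \<and> A s \<subseteq> Y \<and> Y \<subseteq> (T ^^ n) ` A s"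
    and disj: "disjoint_family_on A S"
  shows "ereal (ln (real (card S)) / real n) \<le> top_entropy X T"
proof -
  define f where "f = T ^^ n"
  have "\<exists>\<delta>>0. s \<noteq> t \<longrightarrow> (\<forall>x\<in>A s. \<forall>y\<in>A t. \<delta> \<le> dist x y)" if "s \<in> S" "t \<in> S" for s t
    using separate_compact_closed[of "A s" "A t"] A disj that
    by (cases "s = t") (auto simp: disjoint_family_on_def compact_imp_closed intro: exI[of _ 1])
  then obtain \<delta> where \<delta>: "\<And>s t. s \<in> S \<Longrightarrow> t \<in> S \<Longrightarrow>
      0 < \<delta> s t \<and> (s \<noteq> t \<longrightarrow> (\<forall>x\<in>A s. \<forall>y\<in>A t. \<delta> s t \<le> dist x y))"
    by metis
  define \<eta> where "\<eta> = Min ((\<lambda>(s,t). \<delta> s t) ` (S \<times> S))"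
  \<comment> \<open>Half the gap, because separation demands a distance strictly larger than
    e.\<close>
  define e where "e = \<eta> / 2"
  have fin: "finite ((\<lambda>(s,t). \<delta> s t) ` (S \<times> S))" "(\<lambda>(s,t). \<delta> s t) ` (S \<times> S) \<noteq> {}"
    using S by auto
  have \<eta>: "0 < \<eta>" "\<And>s t. s \<in> S \<Longrightarrow> t \<in> S \<Longrightarrow> \<eta> \<le> \<delta> s t"
    unfolding \<eta>_def using \<delta> Min_in[OF fin] Min_le[OF fin(1)] by (fastforce, force)
  have e: "0 < e" using \<eta> by (simp add: e_def)
  have sep: "e < dist x y" if "s \<in> S" "t \<in> S" "s \<noteq> t" "x \<in> A s" "y \<in> A t" for s t x y
    using \<delta>[OF that(1,2)] \<eta>(1) \<eta>(2)[OF that(1,2)] that by (force simp: e_def)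
  define g where "g s = inv_into (A s) f" for s
  have g: "g s u \<in> A s" "f (g s u) = u" if "s \<in> S" "u \<in> Y" for s u
  proof -
    have "u \<in> f ` A s" using A that unfolding f_def by blast
    then show "g s u \<in> A s" "f (g s u) = u"
      unfolding g_def by (auto intro: inv_into_into f_inv_into_f)
  qed
  have "\<exists>E. E \<subseteq> Y \<and> finite E \<and> card E = card S ^ m \<and>
      (\<forall>x\<in>E. \<forall>y\<in>E. x \<noteq> y \<longrightarrow> (\<exists>k<m. e < dist ((f ^^ k) x) ((f ^^ k) y)))" for m
  proof (induction m)
    case 0
    obtain z where "z \<in> Y" using Y by blast
    then show ?case by (intro exI[of _ "{z}"]) auto
  next
    case (Suc m)
    then obtain E where E: "E \<subseteq> Y" "finite E" "card E = card S ^ m"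
      "\<And>x y. x \<in> E \<Longrightarrow> y \<in> E \<Longrightarrow> x \<noteq> y \<Longrightarrow> \<exists>k<m. e < dist ((f ^^ k) x) ((f ^^ k) y)"
      by blast
    \<comment> \<open>Prefixing a letter s to a word means applying the inverse branch
      \<open>g s\<close>. Points with different first letters are separated at time 0; otherwise the
      separation of u and v is inherited one step later.\<close>
    define E' where "E' = (\<lambda>(s,u). g s u) ` (S \<times> E)"
    have sep': "\<exists>k<Suc m. e < dist ((f ^^ k) (g s u)) ((f ^^ k) (g t v))"
      if st: "s \<in> S" "t \<in> S" "u \<in> E" "v \<in> E" "(s,u) \<noteq> (t,v)" for s t u v
    proof (cases "s = t")
      case True
      then obtain k where k: "k < m" "e < dist ((f ^^ k) u) ((f ^^ k) v)" using E(4)[of u v] st by auto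
      have "(f ^^ Suc k) (g s u) = (f ^^ k) u" "(f ^^ Suc k) (g t v) = (f ^^ k) v"
        using g(2)[of s u] g(2)[of t v] st E(1) by (auto simp: funpow_swap1)
      then show ?thesis using k by (intro exI[of _ "Suc k"]) auto
    next
      case False
      have "e < dist (g s u) (g t v)"
        using st E(1) False by (intro sep[of s t] g) auto
      then show ?thesis by (intro exI[of _ 0]) auto
    qed
    have inj: "inj_on (\<lambda>(s,u). g s u) (S \<times> E)"
    proof (rule inj_onI; clarify)
      fix s u t v assume a: "s \<in> S" "u \<in> E" "t \<in> S" "v \<in> E" "g s u = g t v"
      show "s = t \<and> u = v"
      proof (rule ccontr)
        assume "\<not> (s = t \<and> u = v)"
        then show False using sep'[of s t u v] a e by auto
      qed
    qed
    have "E' \<subseteq> Y"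
    proof
      fix x assume "x \<in> E'"
      then obtain s u where su: "s \<in> S" "u \<in> E" "x = g s u" unfolding E'_def by auto
      then have "x \<in> A s" using g(1)[of s u] E(1) by auto
      then show "x \<in> Y" using A[OF su(1)] by auto
    qed
    moreover have "finite E'" "card E' = card S ^ Suc m"
      unfolding E'_def using S(1) E(2,3) by (simp_all add: card_image[OF inj] card_cartesian_product)
    moreover have "\<forall>x\<in>E'. \<forall>y\<in>E'. x \<noteq> y \<longrightarrow> (\<exists>k<Suc m. e < dist ((f ^^ k) x) ((f ^^ k) y))"
    proof (intro ballI impI)
      fix x y assume "x \<in> E'" "y \<in> E'" "x \<noteq> y"
      then obtain s u t v where "s \<in> S" "u \<in> E" "x = g s u" "t \<in> S" "v \<in> E" "y = g t v"
        unfolding E'_def by auto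
      then show "\<exists>k<Suc m. e < dist ((f ^^ k) x) ((f ^^ k) y)"
        using sep'[of s t u v] \<open>x \<noteq> y\<close> by blast
    qed
    ultimately show ?case by blast
  qed
  then obtain E where E: "\<And>m. E m \<subseteq> Y" "\<And>m. finite (E m)" "\<And>m. card (E m) = card S ^ m"
    "\<And>m x y. x \<in> E m \<Longrightarrow> y \<in> E m \<Longrightarrow> x \<noteq> y \<Longrightarrow> \<exists>k<m. e < dist ((f ^^ k) x) ((f ^^ k) y)"
    by metis
  define a where "a N = (SUP E\<in>{E. finite E \<and> separated_set X T N e E}. ereal (ln (real (card E)) / real N))" for N
  have lower: "ereal (ln (real (card S)) / real n) \<le> a (n * m)" if m: "0 < m" for m
  proof -
    have "separated_set X T (n * m) e (E m)"
      unfolding separated_set_def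
    proof (intro conjI ballI impI)
      show "E m \<subseteq> X" using E(1) Y by blast
      fix x y assume "x \<in> E m" "y \<in> E m" "x \<noteq> y"
      then obtain k where k: "k < m" "e < dist ((f ^^ k) x) ((f ^^ k) y)" using E(4) by blast
      then show "\<exists>k<n * m. e < dist ((T ^^ k) x) ((T ^^ k) y)"
        using n by (intro exI[of _ "n * k"]) (auto simp: f_def funpow_mult)
    qed
    then have "ereal (ln (real (card (E m))) / real (n * m)) \<le> a (n * m)"
      unfolding a_def using E(2) by (intro SUP_upper) auto
    moreover have "ln (real (card (E m))) / real (n * m) = ln (real (card S)) / real n"
      using m S by (simp add: E(3) ln_realpow card_gt_0_iff)
    ultimately show ?thesis by simp
  qed
  have "ereal (ln (real (card S)) / real n) \<le> limsup a"
  proof (rule ccontr)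
    assume "\<not> ereal (ln (real (card S)) / real n) \<le> limsup a"
    then have "eventually (\<lambda>N. a N < ereal (ln (real (card S)) / real n)) sequentially"
      by (intro Limsup_lessD) simp
    then obtain N where N: "\<And>k. N \<le> k \<Longrightarrow> a k < ereal (ln (real (card S)) / real n)"
      unfolding eventually_sequentially by blast
    have "N \<le> n * Suc N" using n by (cases n) auto
    then show False using N[of "n * Suc N"] lower[of "Suc N"] by simp
  qed
  also have "limsup a \<le> top_entropy X T"
    unfolding top_entropy_def a_def using e by (intro SUP_upper) auto
  finally show ?thesis .
qed

context markov_map
begin

text \<open>Branches of T^n from i onto i may share end points, whereas a horseshoe needs disjoint
  sets. Shared points are mapped to a or b, so the branches become disjoint once restricted to the
  preimage of an interval [c,d] strictly inside i. The remaining branches must themselves lie in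
  [c,d], which is why those touching a or b are dropped. The bound is stated for every natural
  number below the entry because the entry could still be infinite.\<close>

lemma ecard_le_entropy:
  assumes i: "i \<in> P" and n: "0 < n" and R: "of_nat R \<le> mat_pow P (transition_matrix T) n i i"
    and h: "top_entropy {0..1} T \<le> ereal h"
  shows "real R \<le> exp h ^ n + 2"
proof (cases "R \<le> 2")
  case True
  have "real R \<le> 2" using True by simp
  also have "\<dots> \<le> exp h ^ n + 2" by simp
  finally show ?thesis .
next
  case False
  obtain a b where ab: "0 \<le> a" "a < b" "b \<le> 1" "i = {a..b}" using cellE i .
  obtain y where y: "a < y" "y < b" "y \<notin> exceptional" using generic_point_exists ab(2) .
  define f where "f = T ^^ n"
  have y_int: "y \<in> interior i" using y ab by simp
  have "of_nat R \<le> ecard {x\<in>i. f x = y}"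
    using R mat_pow_eq_ecard[OF i i y_int y(3)] by (simp add: f_def)
  then obtain S where S: "finite S" "S \<subseteq> {x\<in>i. f x = y}" "card S = R" by (rule of_nat_le_ecardE)
  have "\<forall>x\<in>S. \<exists>p q. p < q \<and> {p..q} \<subseteq> i \<and> x \<in> {p..q} \<and> inj_on f {p..q} \<and> f ` {p..q} = {a..b}"
    using branch_exists[OF i i y_int y(3)] S(2) ab(4) unfolding f_def by blast
  then obtain p q where pq: "\<And>x. x \<in> S \<Longrightarrow>
      p x < q x \<and> {p x..q x} \<subseteq> i \<and> x \<in> {p x..q x} \<and> inj_on f {p x..q x} \<and> f ` {p x..q x} = {a..b}"
    by metis
  have cont: "continuous_on {p x..q x} f" if "x \<in> S" for x
    unfolding f_def using pq[OF that] cell_subset[OF i]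
    by (meson continuous_on_subset funpow_continuous order_trans)
  have same: "x = x'" if "x \<in> S" "x' \<in> S" "p x = p x'" "q x = q x'" for x x'
  proof -
    have "x \<in> {p x..q x}" "x' \<in> {p x..q x}" "f x = f x'" "inj_on f {p x..q x}"
      using pq[OF that(1)] pq[OF that(2)] that(3,4) subsetD[OF S(2) that(1)] subsetD[OF S(2) that(2)]
      by simp_all
    then show ?thesis by (simp add: inj_on_eq_iff)
  qed
  have overlap: "x = x'" if x: "x \<in> S" "x' \<in> S" "max (p x) (p x') < min (q x) (q x')" for x x'
  proof -
    have "p x = p x' \<and> q x = q x'"
      using pq[OF x(1)] pq[OF x(2)]
      by (intro continuous_inj_segments_overlap_eq[where f = f and c = a and d = b] cont x) simp_all
    then show ?thesis using same[OF x(1,2)] by simp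
  qed
  define S' where "S' = {x\<in>S. a < p x \<and> q x < b}"
  have bd: "a \<le> p x" "q x \<le> b" if "x \<in> S" for x using pq[OF that] ab by auto
  have "card {x\<in>S. p x = a} \<le> 1"
  proof (rule card_le_Suc0_iff_eq[THEN iffD2, unfolded One_nat_def[symmetric]])
    show "\<forall>x\<in>{x\<in>S. p x = a}. \<forall>x'\<in>{x\<in>S. p x = a}. x = x'"
    proof (intro ballI)
      fix x x' assume "x \<in> {x\<in>S. p x = a}" "x' \<in> {x\<in>S. p x = a}"
      then show "x = x'" using pq[of x] pq[of x'] by (intro overlap) auto
    qed
  qed (use S in auto)
  moreover have "card {x\<in>S. q x = b} \<le> 1"
  proof (rule card_le_Suc0_iff_eq[THEN iffD2, unfolded One_nat_def[symmetric]])
    show "\<forall>x\<in>{x\<in>S. q x = b}. \<forall>x'\<in>{x\<in>S. q x = b}. x = x'"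
    proof (intro ballI)
      fix x x' assume "x \<in> {x\<in>S. q x = b}" "x' \<in> {x\<in>S. q x = b}"
      then show "x = x'" using pq[of x] pq[of x'] by (intro overlap) auto
    qed
  qed (use S in auto)
  moreover have "S \<subseteq> S' \<union> {x\<in>S. p x = a} \<union> {x\<in>S. q x = b}"
    using bd unfolding S'_def by force
  then have "card S \<le> card (S' \<union> {x\<in>S. p x = a} \<union> {x\<in>S. q x = b})"
    using S(1) by (intro card_mono) (auto simp: S'_def)
  then have "card S \<le> card S' + card {x\<in>S. p x = a} + card {x\<in>S. q x = b}"
    using card_Un_le[of "S' \<union> {x\<in>S. p x = a}" "{x\<in>S. q x = b}"] card_Un_le[of S' "{x\<in>S. p x = a}"]
    by linarith
  ultimately have cS': "R \<le> card S' + 2" using S(3) by linarith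
  then have "card S' \<noteq> 0" using False by linarith
  then have S'0: "finite S'" "S' \<noteq> {}" by (auto simp: card_eq_0_iff)
  \<comment> \<open>The hull of the remaining branches is both the domain and the target of the
    horseshoe.\<close>
  define c d where "c = Min (p ` S')" and "d = Max (q ` S')"
  have cd_bd: "c \<le> p x" "q x \<le> d" if "x \<in> S'" for x
    unfolding c_def d_def using S'0 that by auto
  have "c \<in> p ` S'" "d \<in> q ` S'" unfolding c_def d_def using S'0 by (intro Min_in Max_in; simp)+
  then have cd: "a < c" "d < b" unfolding S'_def by auto
  obtain x0 where x0: "x0 \<in> S'" using S'0 by blast
  have cd': "c \<le> d" using cd_bd[OF x0] pq[of x0] x0 unfolding S'_def by auto
  define A where "A x = {p x..q x} \<inter> f -` {c..d}" for x
  have "ereal (ln (real (card S')) / real n) \<le> top_entropy {0..1} T"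
  proof (rule top_entropy_horseshoe[where Y = "{c..d}" and A = A])
    show "finite S'" "S' \<noteq> {}" using S'0 by auto
    show "{c..d} \<noteq> {}" using cd' by simp
    show "{c..d} \<subseteq> {0..1}" using cd ab by auto
    show "0 < n" by (rule n)
    show "compact (A x) \<and> A x \<subseteq> {c..d} \<and> {c..d} \<subseteq> (T ^^ n) ` A x" if x: "x \<in> S'" for x
    proof (intro conjI)
      have xS: "x \<in> S" using x by (simp add: S'_def)
      have "closed (A x)" unfolding A_def using cont[OF xS] by (intro continuous_closed_preimage) auto
      then have "compact ({p x..q x} \<inter> A x)" by (intro compact_Int_closed) auto
      moreover have "{p x..q x} \<inter> A x = A x" by (auto simp: A_def)
      ultimately show "compact (A x)" by simp
      show "A x \<subseteq> {c..d}" using cd_bd[OF x] unfolding A_def by auto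
      have "{c..d} \<subseteq> f ` {p x..q x}" using pq[OF xS] cd by auto
      then show "{c..d} \<subseteq> (T ^^ n) ` A x" unfolding A_def f_def by blast
    qed
    show "disjoint_family_on A S'"
      unfolding disjoint_family_on_def
    proof (intro ballI impI)
      fix x x' assume x: "x \<in> S'" "x' \<in> S'" "x \<noteq> x'"
      then have xS: "x \<in> S" "x' \<in> S" by (auto simp: S'_def)
      show "A x \<inter> A x' = {}"
      proof (rule ccontr)
        assume "A x \<inter> A x' \<noteq> {}"
        then obtain u where u: "u \<in> {p x..q x}" "u \<in> {p x'..q x'}" "f u \<in> {c..d}" unfolding A_def by blast
        have "p x = p x' \<and> q x = q x'"
          using u pq[OF xS(1)] pq[OF xS(2)] cont xS cd
          by (intro continuous_inj_segments_eq[of "p x" "q x" f a b "p x'" "q x'" u]) auto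
        then show False using same xS x by blast
      qed
    qed
  qed
  also note h
  finally have "ln (real (card S')) \<le> h * real n" using n by (simp add: field_simps)
  then have "real (card S') \<le> exp (h * real n)"
    using \<open>card S' \<noteq> 0\<close> by (metis exp_le_cancel_iff exp_ln of_nat_0_less_iff gr0I)
  then have "real (card S') \<le> exp h ^ n" using exp_of_nat_mult[of n h] by (simp only: mult.commute)
  moreover have "real R \<le> real (card S') + 2" using cS' by linarith
  ultimately show ?thesis by linarith
qed

text \<open>The previous bound first shows that the entry is finite. Applied to the times n * m,
  where the m-th power of the entry is a lower bound, it leaves no room for the additive 2.\<close>

lemma mat_pow_le_exp_entropy:
  assumes i: "i \<in> P" and h: "top_entropy {0..1} T \<le> ereal h" "0 \<le> h"
  shows "mat_pow P (transition_matrix T) n i i \<le> ennreal (exp h ^ n)"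
proof (cases "n = 0")
  case False
  define M where "M = mat_pow P (transition_matrix T)"
  have bound: "real R \<le> exp h ^ k + 2" if "0 < k" "of_nat R \<le> M k i i" for R k
    using ecard_le_entropy[OF i that(1) _ h(1)] that(2) unfolding M_def by blast
  obtain a b where ab: "0 \<le> a" "a < b" "b \<le> 1" "i = {a..b}" using cellE i .
  obtain y where y: "a < y" "y < b" "y \<notin> exceptional" using generic_point_exists ab(2) .
  define S where "S = {x\<in>i. (T ^^ n) x = y}"
  have eq: "M n i i = ecard S"
    unfolding M_def S_def using y ab by (intro mat_pow_eq_ecard[OF i i]) auto
  have "finite S"
  proof (rule ccontr)
    assume "infinite S"
    then have top: "M n i i = \<infinity>" using eq ecard_infinite by simp
    obtain R :: nat where "exp h ^ n + 2 < real R" using reals_Archimedean2 by blast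
    then show False using bound[of n R] False top by simp
  qed
  then have N: "M n i i = of_nat (card S)" using eq by simp
  define r where "r = exp h ^ n"
  have r: "1 \<le> r" unfolding r_def using h(2) by (intro one_le_power) simp
  have "real (card S) \<le> r"
  proof (rule ccontr)
    assume "\<not> real (card S) \<le> r"
    then have "1 < real (card S) / r" using r by (simp add: field_simps)
    \<comment> \<open>The constant 3 comes from r^m + 2 <= 3 r^m, valid because r >= 1.\<close>
    then obtain m where m: "3 < (real (card S) / r) ^ m" using real_arch_pow by blast
    then have m0: "0 < m" by (cases m) auto
    have "of_nat (card S ^ m) \<le> M (n * m) i i"
      using mat_pow_power_le[OF i, of "transition_matrix T" n m] N unfolding M_def by simp
    then have "real (card S ^ m) \<le> r ^ m + 2"
      using bound[of "n * m" "card S ^ m"] False m0 unfolding r_def by (simp add: power_mult)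
    moreover have "1 \<le> r ^ m" using r by simp
    moreover have "3 * r ^ m < real (card S) ^ m"
      using m r by (simp add: power_divide field_simps)
    ultimately show False by simp
  qed
  then show ?thesis using N unfolding M_def r_def by (simp add: ennreal_of_nat_eq_real_of_nat ennreal_leI)
qed simp

end

section \<open>Counting itineraries\<close>

text \<open>For N > 0 this numbers half-open pieces of [0,1] of length 1/N. The point 1 alone has
  the letter N, so the letters run from 0 to N.\<close>

definition letter :: "nat \<Rightarrow> real \<Rightarrow> nat" where
  "letter N x = nat \<lfloor>real N * x\<rfloor>"

definition itinerary :: "nat \<Rightarrow> (real \<Rightarrow> real) \<Rightarrow> nat \<Rightarrow> real \<Rightarrow> nat list" where
  "itinerary N f n x = map (\<lambda>k. letter N ((f ^^ k) x)) [0..<n]"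

definition cylinder :: "nat \<Rightarrow> nat \<Rightarrow> real set" where
  "cylinder N a = {x\<in>{0..1}. letter N x = a}"

lemma letter_mono: "x \<le> y \<Longrightarrow> letter N x \<le> letter N y"
  unfolding letter_def by (intro nat_mono floor_mono mult_left_mono) auto

lemma letter_le: "x \<le> 1 \<Longrightarrow> letter N x \<le> N"
  using letter_mono[of x 1 N] by (simp add: letter_def)

lemma finite_letters:
  assumes "K \<subseteq> {0..1}"
  shows "finite (letter N ` K)"
proof (rule finite_subset)
  show "letter N ` K \<subseteq> {..N}"
    using assms by (intro image_subsetI) (auto intro!: letter_le)
qed simp

lemma is_interval_letter:
  assumes "is_interval K"
  shows "is_interval {x\<in>K. letter N x = a}"
  unfolding is_interval_1
proof (intro ballI allI impI, elim conjE)
  fix x y z assume z: "x \<in> {x\<in>K. letter N x = a}" "y \<in> {x\<in>K. letter N x = a}" "x \<le> z" "z \<le> y"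
  then have "z \<in> K" using assms unfolding is_interval_1 by blast
  moreover have "letter N z = a"
    using letter_mono[OF z(3), of N] letter_mono[OF z(4), of N] z(1,2) by simp
  ultimately show "z \<in> {x\<in>K. letter N x = a}" by simp
qed

lemma letter_eq_iff:
  assumes "0 \<le> x" "0 < N"
  shows "letter N x = a \<longleftrightarrow> real a / real N \<le> x \<and> x < (real a + 1) / real N"
proof -
  have "letter N x = a \<longleftrightarrow> \<lfloor>real N * x\<rfloor> = int a"
    using assms unfolding letter_def by (simp add: nat_eq_iff)
  also have "\<dots> \<longleftrightarrow> real a \<le> real N * x \<and> real N * x < real a + 1"
    by (simp add: floor_eq_iff)
  finally show ?thesis using assms by (simp add: field_simps)
qed

lemma letter_eq_imp_dist:
  assumes "x \<in> {0..1}" "y \<in> {0..1}" "letter N x = letter N y" "0 < N"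
  shows "dist x y < 1 / real N"
proof -
  have "real (letter N x) / real N \<le> x \<and> x < (real (letter N x) + 1) / real N"
    "real (letter N x) / real N \<le> y \<and> y < (real (letter N x) + 1) / real N"
    using assms letter_eq_iff[of x N "letter N x"] letter_eq_iff[of y N "letter N x"] by auto
  then show ?thesis unfolding dist_real_def by (auto simp: add_divide_distrib abs_less_iff)
qed

lemma itinerary_Suc: "itinerary N f (Suc n) x = letter N x # itinerary N f n (f x)"
  unfolding itinerary_def map_upt_Suc by (simp add: funpow_swap1)

lemma itinerary_Suc_image:
  "itinerary N f (Suc n) ` {x\<in>K. letter N x = a} = Cons a ` itinerary N f n ` f ` {x\<in>K. letter N x = a}"
  unfolding image_image itinerary_Suc by (intro image_cong) auto

lemma funpow_maps_into:
  assumes "f ` X \<subseteq> X" "x \<in> X"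
  shows "(f ^^ n) x \<in> X"
  using assms by (induction n) (auto simp: image_subset_iff)

lemma finite_itineraries:
  assumes "f ` {0..1} \<subseteq> {0..1}" "K \<subseteq> {0..1}"
  shows "finite (itinerary N f n ` K)"
proof (rule finite_subset)
  show "itinerary N f n ` K \<subseteq> {xs. set xs \<subseteq> {..N} \<and> length xs = n}"
  proof (intro subsetI CollectI)
    fix xs assume "xs \<in> itinerary N f n ` K"
    then obtain x where x: "x \<in> {0..1}" "xs = itinerary N f n x" using assms(2) by blast
    have "letter N ((f ^^ k) x) \<le> N" for k
      using funpow_maps_into[OF assms(1) x(1)] by (intro letter_le) auto
    then show "set xs \<subseteq> {..N} \<and> length xs = n" using x(2) by (auto simp: itinerary_def)
  qed
qed (simp add: finite_lists_length_eq)

lemma card_itineraries_Suc_le: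
  assumes f: "f ` {0..1} \<subseteq> {0..1}" and K: "K \<subseteq> {0..1}"
  shows "card (itinerary N f (Suc n) ` K) \<le>
    (\<Sum>a\<in>letter N ` K. card (itinerary N f n ` f ` {x\<in>K. letter N x = a}))"
proof -
  note fin = finite_letters[OF K, of N]
  have "itinerary N f (Suc n) ` K =
      (\<Union>a\<in>letter N ` K. Cons a ` itinerary N f n ` f ` {x\<in>K. letter N x = a})"
    unfolding itinerary_Suc_image[symmetric] by blast
  then have "card (itinerary N f (Suc n) ` K) \<le>
      (\<Sum>a\<in>letter N ` K. card (Cons a ` itinerary N f n ` f ` {x\<in>K. letter N x = a}))"
    using card_UN_le[OF fin] by simp
  also have "\<dots> \<le> (\<Sum>a\<in>letter N ` K. card (itinerary N f n ` f ` {x\<in>K. letter N x = a}))"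
  proof (intro sum_mono card_image_le finite_itineraries[OF f])
    fix a
    show "f ` {x\<in>K. letter N x = a} \<subseteq> {0..1}" using f K by blast
  qed
  finally show ?thesis .
qed

text \<open>A letter strictly between the smallest and the largest letter met by K has its whole
  cylinder inside K, hence also its marked point. Not counted in this way are the two extreme
  letters and the unmarked letters 0, N - 1 and N: five in all.\<close>

lemma interval_letters:
  assumes K: "is_interval K" "K \<subseteq> {0..1}"
    and Y: "\<And>a. a \<in> {1..<N - 1} \<Longrightarrow> Y a \<in> cylinder N a"
    and fin: "finite {x\<in>K. x \<in> Y ` {1..<N - 1}}"
  shows "card (letter N ` K) \<le> 5 + card {x\<in>K. x \<in> Y ` {1..<N - 1}}"
proof (cases "K = {}")
  case False
  note finL = finite_letters[OF K(2), of N]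
  define a b where "a = Min (letter N ` K)" and "b = Max (letter N ` K)"
  have "a \<in> letter N ` K" "b \<in> letter N ` K"
    unfolding a_def b_def using finL False by (intro Min_in Max_in; simp)+
  then obtain u v where uv: "u \<in> K" "v \<in> K" "letter N u = a" "letter N v = b" by auto
  define Z where "Z = {l\<in>{1..<N - 1}. Y l \<in> K}"
  have sub: "letter N ` K \<subseteq> set [0, N - 1, N, a, b] \<union> Z"
  proof
    fix l assume l: "l \<in> letter N ` K"
    show "l \<in> set [0, N - 1, N, a, b] \<union> Z"
    proof (rule ccontr)
      assume n: "l \<notin> set [0, N - 1, N, a, b] \<union> Z"
      have "l \<le> N" using l K(2) letter_le by auto
      then have mid: "l \<in> {1..<N - 1}" using n by auto
      have "a \<le> l" "l \<le> b" unfolding a_def b_def using l finL by auto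
      then have ab: "a < l" "l < b" using n by auto
      have Yl: "letter N (Y l) = l" using Y[OF mid] by (simp add: cylinder_def)
      have "u \<le> Y l" "Y l \<le> v"
        using letter_mono[of "Y l" u N] letter_mono[of v "Y l" N] ab uv Yl by linarith+
      moreover have "{u..v} \<subseteq> K"
        using K(1) uv connected_contains_Icc[of K u v] by (simp add: is_interval_connected_1)
      ultimately have "Y l \<in> K" by auto
      then show False using n mid by (simp add: Z_def)
    qed
  qed
  have finZ: "finite Z" unfolding Z_def by simp
  have "letter N (Y l) = l" if "l \<in> Z" for l using Y[of l] that by (simp add: Z_def cylinder_def)
  then have "inj_on Y Z" by (metis inj_onI)
  then have "card Z \<le> card {x\<in>K. x \<in> Y ` {1..<N - 1}}"
    using fin by (intro card_inj_on_le[of Y]) (auto simp: Z_def)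
  moreover have "card (letter N ` K) \<le> card (set [0, N - 1, N, a, b]) + card Z"
    using card_mono[OF _ sub] card_Un_le[of "set [0, N - 1, N, a, b]" Z] finZ by simp
  moreover have "card (set [0, N - 1, N, a, b]) \<le> 5" using card_length[of "[0, N - 1, N, a, b]"] by simp
  ultimately show ?thesis by linarith
qed simp

text \<open>The summand for k can be read as follows: k is the last time at which the itinerary
  takes a letter paid for by its marked point. The preimage of that point fixes all letters up to
  time k, and five choices remain for each later step. In the induction the image of each piece
  \<open>Ka a\<close> is again an interval.\<close>

lemma card_itineraries_interval_le:
  assumes f: "continuous_on {0..1} f" "f ` {0..1} \<subseteq> {0..1}"
    and Y: "\<And>a. a \<in> {1..<N - 1} \<Longrightarrow> Y a \<in> cylinder N a"
    and K: "is_interval K" "K \<subseteq> {0..1}"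
    and fin: "\<And>k. finite {x\<in>K. (f ^^ k) x \<in> Y ` {1..<N - 1}}"
  shows "card (itinerary N f n ` K) \<le>
    5 ^ n + (\<Sum>k<n. 5 ^ (n - Suc k) * card {x\<in>K. (f ^^ k) x \<in> Y ` {1..<N - 1}})"
  using K fin
proof (induction n arbitrary: K)
  case 0
  have "itinerary N f 0 ` K \<subseteq> {[]}" by (auto simp: itinerary_def)
  then show ?case using card_mono[of "{[]}" "itinerary N f 0 ` K"] by simp
next
  case (Suc n)
  define W where "W = Y ` {1..<N - 1}"
  define q where "q k K = card {x\<in>K. (f ^^ k) x \<in> W}" for k K
  define Ka where "Ka a = {x\<in>K. letter N x = a}" for a
  have finq: "finite {x\<in>K. (f ^^ k) x \<in> W}" for k using Suc.prems(3) by (simp add: W_def)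
  note finL = finite_letters[OF Suc.prems(2), of N]
  have step: "card (itinerary N f n ` f ` Ka a) \<le> 5 ^ n + (\<Sum>k<n. 5 ^ (n - Suc k) * q (Suc k) (Ka a))" for a
  proof -
    have Ka: "Ka a \<subseteq> {0..1}" using Suc.prems(2) by (auto simp: Ka_def)
    have "is_interval (Ka a)" unfolding Ka_def by (rule is_interval_letter[OF Suc.prems(1)])
    then have int: "is_interval (f ` Ka a)"
      unfolding is_interval_connected_1
      by (intro connected_continuous_image continuous_on_subset[OF f(1) Ka])
    \<comment> \<open>f may fold \<open>Ka a\<close>, so the marked points are counted upstairs,
      where the pieces are disjoint, at the price of an inequality.\<close>
    have sub: "{z\<in>f ` Ka a. (f ^^ k) z \<in> W} \<subseteq> f ` {x\<in>Ka a. (f ^^ Suc k) x \<in> W}" for k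
      by (auto simp: funpow_swap1)
    have finKa: "finite {x\<in>Ka a. (f ^^ k) x \<in> W}" for k
      using finq[of k] by (rule rev_finite_subset) (auto simp: Ka_def)
    have fin': "finite {z\<in>f ` Ka a. (f ^^ k) z \<in> W}" for k
      using sub[of k] finKa[of "Suc k"] by (meson finite_imageI finite_subset)
    have le: "q k (f ` Ka a) \<le> q (Suc k) (Ka a)" for k
      using card_mono[OF _ sub[of k]] card_image_le[OF finKa[of "Suc k"], of f] finKa[of "Suc k"]
      unfolding q_def by (meson finite_imageI le_trans)
    have "card (itinerary N f n ` f ` Ka a) \<le> 5 ^ n + (\<Sum>k<n. 5 ^ (n - Suc k) * q k (f ` Ka a))"
      unfolding q_def W_def
    proof (rule Suc.IH)
      show "is_interval (f ` Ka a)" by (rule int)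
      show "f ` Ka a \<subseteq> {0..1}" using Ka f(2) by blast
      show "finite {x\<in>f ` Ka a. (f ^^ k) x \<in> Y ` {1..<N - 1}}" for k using fin'[of k] by (simp add: W_def)
    qed
    also have "\<dots> \<le> 5 ^ n + (\<Sum>k<n. 5 ^ (n - Suc k) * q (Suc k) (Ka a))"
      using le by (intro add_left_mono sum_mono mult_left_mono) auto
    finally show ?thesis .
  qed
  have part: "(\<Sum>a\<in>letter N ` K. q k (Ka a)) = q k K" for k
  proof -
    have "{x\<in>K. (f ^^ k) x \<in> W} = (\<Union>a\<in>letter N ` K. {x\<in>Ka a. (f ^^ k) x \<in> W})"
      by (auto simp: Ka_def)
    moreover have "card (\<Union>a\<in>letter N ` K. {x\<in>Ka a. (f ^^ k) x \<in> W}) =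
        (\<Sum>a\<in>letter N ` K. card {x\<in>Ka a. (f ^^ k) x \<in> W})"
    proof (rule card_UN_disjoint[OF finL])
      show "\<forall>a\<in>letter N ` K. finite {x\<in>Ka a. (f ^^ k) x \<in> W}"
        using finq[of k] by (auto intro!: rev_finite_subset[OF finq[of k]] simp: Ka_def)
    qed (auto simp: Ka_def)
    ultimately show ?thesis unfolding q_def by simp
  qed
  have "card (itinerary N f (Suc n) ` K) \<le> (\<Sum>a\<in>letter N ` K. card (itinerary N f n ` f ` Ka a))"
    unfolding Ka_def using Suc.prems(2) f(2) by (intro card_itineraries_Suc_le)
  also have "\<dots> \<le> (\<Sum>a\<in>letter N ` K. 5 ^ n + (\<Sum>k<n. 5 ^ (n - Suc k) * q (Suc k) (Ka a)))"
    by (intro sum_mono step)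
  also have "\<dots> = card (letter N ` K) * 5 ^ n +
      (\<Sum>a\<in>letter N ` K. \<Sum>k<n. 5 ^ (n - Suc k) * q (Suc k) (Ka a))"
    by (simp add: sum.distrib)
  also have "(\<Sum>a\<in>letter N ` K. \<Sum>k<n. 5 ^ (n - Suc k) * q (Suc k) (Ka a)) =
      (\<Sum>k<n. 5 ^ (n - Suc k) * q (Suc k) K)"
    by (subst sum.swap) (simp add: sum_distrib_left[symmetric] part)
  also have "card (letter N ` K) * 5 ^ n \<le> (5 + q 0 K) * 5 ^ n"
    using interval_letters[OF Suc.prems(1,2) Y] finq[of 0] by (simp add: q_def W_def)
  finally have "card (itinerary N f (Suc n) ` K) \<le>
      (5 + q 0 K) * 5 ^ n + (\<Sum>k<n. 5 ^ (n - Suc k) * q (Suc k) K)" by simp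
  also have "\<dots> = 5 ^ Suc n + (\<Sum>k<Suc n. 5 ^ (Suc n - Suc k) * q k K)"
    by (subst sum.lessThan_Suc_shift) (simp add: algebra_simps)
  finally show ?case by (simp only: q_def W_def)
qed

text \<open>
  The cylinders of the letters \<open>0\<close>, \<open>N - 1\<close> and \<open>N\<close> reach the end points of the interval, where mixing
  gives no control of preimage counts; they are bounded trivially by all shorter itineraries, at the
  cost of a factor 3 per step.
\<close>

lemma itinerary_growth:
  fixes \<rho> Q :: real
  assumes f: "continuous_on {0..1} f" "f ` {0..1} \<subseteq> {0..1}"
    and Y: "\<And>a. a \<in> {1..<N - 1} \<Longrightarrow> Y a \<in> cylinder N a"
    and \<rho>: "6 \<le> \<rho>" and Q: "0 \<le> Q"
    and count: "\<And>a k. a \<in> {1..<N - 1} \<Longrightarrow> finite {x\<in>cylinder N a. (f ^^ k) x \<in> Y ` {1..<N - 1}} \<and>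
      real (card {x\<in>cylinder N a. (f ^^ k) x \<in> Y ` {1..<N - 1}}) \<le> Q * \<rho> ^ k"
  obtains D where "1 \<le> D" "\<And>n. real (card (itinerary N f n ` {0..1})) \<le> D * \<rho> ^ n"
proof -
  \<comment> \<open>The first use of 6: the induction step needs 5 + 1 <= \<rho>.\<close>
  have geo: "(\<Sum>k<n. 5 ^ (n - Suc k) * \<rho> ^ k) \<le> \<rho> ^ n" for n
  proof (induction n)
    case (Suc n)
    have "(\<Sum>k<n. 5 ^ (Suc n - Suc k) * \<rho> ^ k) = 5 * (\<Sum>k<n. 5 ^ (n - Suc k) * \<rho> ^ k)"
      unfolding sum_distrib_left
    proof (rule sum.cong)
      fix k assume "k \<in> {..<n}"
      then have "Suc n - Suc k = Suc (n - Suc k)" by auto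
      then show "5 ^ (Suc n - Suc k) * \<rho> ^ k = 5 * (5 ^ (n - Suc k) * \<rho> ^ k)" by simp
    qed simp
    then have "(\<Sum>k<Suc n. 5 ^ (Suc n - Suc k) * \<rho> ^ k) \<le> 5 * \<rho> ^ n + \<rho> ^ n"
      using Suc by simp
    also have "\<dots> \<le> \<rho> * \<rho> ^ n" using mult_right_mono[OF \<rho>, of "\<rho> ^ n"] \<rho> by simp
    finally show ?case by simp
  qed simp
  have mid: "real (card (itinerary N f n ` cylinder N a)) \<le> (1 + Q) * \<rho> ^ n" if a: "a \<in> {1..<N - 1}" for a n
  proof -
    have cyl: "is_interval (cylinder N a)" "cylinder N a \<subseteq> {0..1}"
      unfolding cylinder_def by (rule is_interval_letter[OF is_interval_cc]) blast
    define q where "q k = card {x\<in>cylinder N a. (f ^^ k) x \<in> Y ` {1..<N - 1}}" for k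
    have "card (itinerary N f n ` cylinder N a) \<le> 5 ^ n + (\<Sum>k<n. 5 ^ (n - Suc k) * q k)"
      unfolding q_def using count[OF a] by (intro card_itineraries_interval_le[OF f Y cyl]) simp_all
    then have "real (card (itinerary N f n ` cylinder N a)) \<le> real (5 ^ n + (\<Sum>k<n. 5 ^ (n - Suc k) * q k))"
      by (rule of_nat_mono)
    also have "\<dots> = 5 ^ n + (\<Sum>k<n. 5 ^ (n - Suc k) * real (q k))" by simp
    also have "\<dots> \<le> \<rho> ^ n + (\<Sum>k<n. 5 ^ (n - Suc k) * (Q * \<rho> ^ k))"
      using \<rho> count[OF a] by (intro add_mono power_mono sum_mono mult_left_mono) (auto simp: q_def)
    also have "(\<Sum>k<n. 5 ^ (n - Suc k) * (Q * \<rho> ^ k)) = Q * (\<Sum>k<n. 5 ^ (n - Suc k) * \<rho> ^ k)"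
      unfolding sum_distrib_left by (intro sum.cong) (auto simp: algebra_simps)
    also have "\<rho> ^ n + Q * (\<Sum>k<n. 5 ^ (n - Suc k) * \<rho> ^ k) \<le> \<rho> ^ n + Q * \<rho> ^ n"
      using geo[of n] Q by (intro add_left_mono mult_left_mono)
    finally show ?thesis by (simp add: algebra_simps)
  qed
  define V where "V n = card (itinerary N f n ` {0..1})" for n
  define C where "C = real N * (1 + Q)"
  have C0: "0 \<le> C" using Q by (simp add: C_def)
  \<comment> \<open>Itineraries that start in an end letter are counted by their tails, which are
    arbitrary itineraries of length n.\<close>
  have rec: "real (V (Suc n)) \<le> C * \<rho> ^ Suc n + 3 * real (V n)" for n
  proof -
    have "itinerary N f (Suc n) ` {0..1} =
        (\<Union>a\<in>{1..<N - 1}. itinerary N f (Suc n) ` cylinder N a) \<union>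
        (\<Union>a\<in>{0, N - 1, N}. itinerary N f (Suc n) ` cylinder N a)" (is "_ = ?A \<union> ?B")
    proof
      show "itinerary N f (Suc n) ` {0..1} \<subseteq> ?A \<union> ?B"
      proof
        fix xs assume "xs \<in> itinerary N f (Suc n) ` {0..1}"
        then obtain x where x: "x \<in> {0..1}" "xs = itinerary N f (Suc n) x" by blast
        then have "x \<in> cylinder N (letter N x)" by (simp add: cylinder_def)
        moreover have "letter N x \<in> {1..<N - 1} \<union> {0, N - 1, N}"
          using letter_le[of x N] x(1) by auto
        ultimately show "xs \<in> ?A \<union> ?B" using x(2) by blast
      qed
    qed (auto simp: cylinder_def)
    then have "V (Suc n) \<le> card ?A + card ?B" unfolding V_def using card_Un_le by metis
    moreover have "real (card ?A) \<le> C * \<rho> ^ Suc n"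
    proof -
      have "card ?A \<le> (\<Sum>a\<in>{1..<N - 1}. card (itinerary N f (Suc n) ` cylinder N a))"
        by (rule card_UN_le) simp
      then have "real (card ?A) \<le> (\<Sum>a\<in>{1..<N - 1}. real (card (itinerary N f (Suc n) ` cylinder N a)))"
        by (metis of_nat_mono of_nat_sum)
      also have "\<dots> \<le> (\<Sum>a\<in>{1..<N - 1}. (1 + Q) * \<rho> ^ Suc n)"
        by (intro sum_mono mid)
      also have "\<dots> = real (N - 1 - 1) * ((1 + Q) * \<rho> ^ Suc n)" by simp
      also have "\<dots> \<le> real N * ((1 + Q) * \<rho> ^ Suc n)"
        using Q \<rho> by (intro mult_right_mono) auto
      finally show ?thesis by (simp add: C_def)
    qed
    moreover have "card ?B \<le> 3 * V n"
    proof -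
      have "card (itinerary N f (Suc n) ` cylinder N a) \<le> V n" for a
      proof -
        have sub: "f ` cylinder N a \<subseteq> {0..1}" using f(2) by (auto simp: cylinder_def)
        have "card (itinerary N f (Suc n) ` cylinder N a) \<le> card (itinerary N f n ` f ` cylinder N a)"
          unfolding cylinder_def itinerary_Suc_image
          using sub by (intro card_image_le finite_itineraries[OF f(2)]) (simp add: cylinder_def)
        also have "\<dots> \<le> V n"
          unfolding V_def using sub by (intro card_mono finite_itineraries[OF f(2)] image_mono) auto
        finally show ?thesis .
      qed
      then have "(\<Sum>a\<in>{0, N - 1, N}. card (itinerary N f (Suc n) ` cylinder N a)) \<le> card {0, N - 1, N} * V n"
        using sum_bounded_above[of "{0, N - 1, N}" "\<lambda>a. card (itinerary N f (Suc n) ` cylinder N a)" "V n"]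
        by (simp only: of_nat_id)
      moreover have "card ?B \<le> (\<Sum>a\<in>{0, N - 1, N}. card (itinerary N f (Suc n) ` cylinder N a))"
        by (rule card_UN_le) simp
      moreover have "card {0, N - 1, N} * V n \<le> 3 * V n"
        using card_length[of "[0, N - 1, N]"] by (intro mult_right_mono) auto
      ultimately show ?thesis by linarith
    qed
    ultimately show ?thesis by linarith
  qed
  \<comment> \<open>Chosen so that C + D / 2 = D - 1. The second use of 6 is 3 <= \<rho> / 2, which
    turns the recursion into a contribution of at most D / 2.\<close>
  define D where "D = 2 * (1 + C)"
  have "real (V n) \<le> D * \<rho> ^ n" for n
  proof (induction n)
    case 0
    have "itinerary N f 0 ` {0..1} \<subseteq> {[]}" by (auto simp: itinerary_def)
    then have "V 0 \<le> 1" using card_mono[of "{[]}" "itinerary N f 0 ` {0..1}"] by (simp add: V_def)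
    then show ?case using C0 by (simp add: D_def)
  next
    case (Suc n)
    have "real (V (Suc n)) \<le> C * \<rho> ^ Suc n + 3 * (D * \<rho> ^ n)" using rec[of n] Suc by simp
    also have "3 * (D * \<rho> ^ n) \<le> (D / 2) * (\<rho> * \<rho> ^ n)"
      using mult_right_mono[OF \<rho>, of "\<rho> ^ n"] mult_left_mono[of "6 * \<rho> ^ n" "\<rho> * \<rho> ^ n" "D / 2"] \<rho> C0
      by (simp add: D_def)
    also have "C * \<rho> ^ Suc n + (D / 2) * (\<rho> * \<rho> ^ n) = (D - 1) * \<rho> ^ Suc n"
      by (simp add: D_def algebra_simps)
    also have "\<dots> \<le> D * \<rho> ^ Suc n" using \<rho> by (intro mult_right_mono) auto
    finally show ?case by simp
  qed
  moreover have "1 \<le> D" using C0 by (simp add: D_def)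
  ultimately show ?thesis using that unfolding V_def by blast
qed

section \<open>The entropy is bounded by the growth of the transition matrix\<close>

context markov_map
begin

text \<open>Itineraries of f = T^p see an orbit of T only at multiples of p; uniform continuity
  controls the times in between.\<close>

lemma uniformly_close_iterates:
  assumes "0 < e"
  obtains \<delta> where "0 < \<delta>"
    "\<And>r x y. r < p \<Longrightarrow> x \<in> {0..1} \<Longrightarrow> y \<in> {0..1} \<Longrightarrow> dist x y < \<delta> \<Longrightarrow> dist ((T ^^ r) x) ((T ^^ r) y) \<le> e"
proof -
  have "\<exists>\<delta>>0. \<forall>r<p. \<forall>x\<in>{0..1}. \<forall>y\<in>{0..1}. dist x y < \<delta> \<longrightarrow> dist ((T ^^ r) x) ((T ^^ r) y) \<le> e"
  proof (induction p)
    case 0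
    then show ?case by (intro exI[of _ 1]) simp
  next
    case (Suc p)
    then obtain \<delta>1 where \<delta>1: "0 < \<delta>1"
      "\<forall>r<p. \<forall>x\<in>{0..1}. \<forall>y\<in>{0..1}. dist x y < \<delta>1 \<longrightarrow> dist ((T ^^ r) x) ((T ^^ r) y) \<le> e"
      by blast
    have "uniformly_continuous_on {0..1} (T ^^ p)"
      by (intro compact_uniformly_continuous funpow_continuous) simp
    then obtain \<delta>2 where \<delta>2: "0 < \<delta>2"
      "\<forall>x\<in>{0..1}. \<forall>y\<in>{0..1}. dist y x < \<delta>2 \<longrightarrow> dist ((T ^^ p) y) ((T ^^ p) x) < e"
      using assms unfolding uniformly_continuous_on_def by metis
    show ?case
    proof (intro exI[of _ "min \<delta>1 \<delta>2"] conjI allI impI ballI)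
      fix r :: nat and x y :: real
      assume "r < Suc p" "x \<in> {0..1}" "y \<in> {0..1}" "dist x y < min \<delta>1 \<delta>2"
      then show "dist ((T ^^ r) x) ((T ^^ r) y) \<le> e"
        using \<delta>1(2) \<delta>2(2) by (cases "r = p") (auto simp: less_Suc_eq intro: less_imp_le)
    qed (use \<delta>1 \<delta>2 in auto)
  qed
  then show ?thesis using that by blast
qed

text \<open>For fixed e the letters are made so short that points with the same f-itinerary cannot
  be separated by T. A separated set then injects into the itineraries, whose number grows at most
  like \<theta>^n as soon as the preimages of the marked points do.\<close>

lemma top_entropy_le_ln_growth:
  assumes \<theta>: "1 < \<theta>" and P: "P \<noteq> {}"
    and growth: "\<And>i j. i \<in> P \<Longrightarrow> j \<in> P \<Longrightarrow>
      \<exists>C. 0 \<le> C \<and> (\<forall>n. mat_pow P (transition_matrix T) n i j \<le> ennreal (C * \<theta> ^ n))"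
  shows "top_entropy {0..1} T \<le> ereal (ln \<theta>)"
proof -
  obtain p where p: "6 < \<theta> ^ p" using real_arch_pow[OF \<theta>] by blast
  then have p0: "0 < p" by (cases p) auto
  define f where "f = T ^^ p"
  define \<rho> where "\<rho> = \<theta> ^ p"
  have f: "continuous_on {0..1} f" "f ` {0..1} \<subseteq> {0..1}"
    unfolding f_def using funpow_continuous funpow_in by blast+
  have \<rho>: "6 \<le> \<rho>" using p by (simp add: \<rho>_def)
  obtain i where i: "i \<in> P" using P by blast
  obtain ai bi where iab: "0 \<le> ai" "ai < bi" "bi \<le> 1" "i = {ai..bi}" using cellE i .
  have bound: "limsup (\<lambda>n. SUP E\<in>{E. finite E \<and> separated_set {0..1} T n e E}.
      ereal (ln (real (card E)) / real n)) \<le> ereal (ln \<theta>)" if e: "0 < e" for e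
  proof -
    obtain \<delta> where \<delta>: "0 < \<delta>"
      "\<And>r x y. r < p \<Longrightarrow> x \<in> {0..1} \<Longrightarrow> y \<in> {0..1} \<Longrightarrow> dist x y < \<delta> \<Longrightarrow> dist ((T ^^ r) x) ((T ^^ r) y) \<le> e"
      using uniformly_close_iterates[OF e] by blast
    obtain N where N: "0 < N" "1 / real N < \<delta>"
      using reals_Archimedean[OF \<delta>(1)] by (metis inverse_eq_divide zero_less_Suc)
    have "\<exists>y. y \<in> cylinder N a \<and> y \<notin> exceptional" if a: "a \<in> {1..<N - 1}" for a
    proof -
      obtain y where y: "real a / real N < y" "y < (real a + 1) / real N" "y \<notin> exceptional"
        using generic_point_exists[of "real a / real N" "(real a + 1) / real N"] N(1)
        by (auto simp: field_simps)
      have "0 \<le> real a / real N" by simp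
      then have "0 \<le> y" using y by linarith
      moreover have "real a + 1 \<le> real N" using a by auto
      then have "(real a + 1) / real N \<le> 1" using N(1) by simp
      then have "y \<le> 1" using y by linarith
      moreover have "letter N y = a" using y letter_eq_iff[OF \<open>0 \<le> y\<close> N(1)] by auto
      ultimately show ?thesis using y(3) by (auto simp: cylinder_def)
    qed
    then obtain Y where Y: "\<And>a. a \<in> {1..<N - 1} \<Longrightarrow> Y a \<in> cylinder N a \<and> Y a \<notin> exceptional"
      by metis
    have "\<exists>j\<in>P. Y a \<in> interior j" if a: "a \<in> {1..<N - 1}" for a
      using generic_preimage_in_cell[of "Y a" 0] Y[OF a] by (auto simp: cylinder_def)
    then obtain J where J: "\<And>a. a \<in> {1..<N - 1} \<Longrightarrow> J a \<in> P \<and> Y a \<in> interior (J a)" by metis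
    have "\<forall>a\<in>{1..<N - 1}. \<exists>C. 0 \<le> C \<and> (\<forall>n. mat_pow P (transition_matrix T) n i (J a) \<le> ennreal (C * \<theta> ^ n))"
      using growth[OF i] J by blast
    then obtain C where C: "\<And>a. a \<in> {1..<N - 1} \<Longrightarrow> 0 \<le> C a"
      "\<And>a n. a \<in> {1..<N - 1} \<Longrightarrow> mat_pow P (transition_matrix T) n i (J a) \<le> ennreal (C a * \<theta> ^ n)"
      by metis
    have fibre: "finite {u\<in>i. (T ^^ n) u = Y a} \<and> real (card {u\<in>i. (T ^^ n) u = Y a}) \<le> C a * \<theta> ^ n"
      if a: "a \<in> {1..<N - 1}" for a n
    proof -
      have le: "ecard {u\<in>i. (T ^^ n) u = Y a} \<le> ennreal (C a * \<theta> ^ n)"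
        using C(2)[OF a] mat_pow_eq_ecard[OF i, of "J a" "Y a" n] J[OF a] Y[OF a] by metis
      have fin: "finite {u\<in>i. (T ^^ n) u = Y a}"
      proof (rule ccontr)
        assume "infinite {u\<in>i. (T ^^ n) u = Y a}"
        from ecard_infinite[OF this] le show False by (simp add: top_unique)
      qed
      have "0 \<le> C a * \<theta> ^ n" using C(1)[OF a] \<theta> by simp
      then show ?thesis
        using fin le by (simp add: ennreal_of_nat_eq_real_of_nat)
    qed
    have N': "0 < 1 / real N" "1 - 1 / real N < 1" using N(1) by auto
    \<comment> \<open>All marked letters lie in this interval. Points x of such a letter lift to u
      in the fixed cell i with x = T^m u, so preimages of marked points are counted by row i of
      powers of the matrix.\<close>
    obtain m where m: "{1 / real N..1 - 1 / real N} \<subseteq> (T ^^ m) ` i"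
    proof (rule eventually_covers[OF iab(1-3) N'])
      fix m assume "\<And>k. m \<le> k \<Longrightarrow> {1 / real N..1 - 1 / real N} \<subseteq> (T ^^ k) ` {ai..bi}"
      from this[of m] show thesis using iab(4) by (intro that) simp
    qed
    define Q where "Q = (\<Sum>b\<in>{1..<N - 1}. C b) * \<theta> ^ m"
    have Q: "0 \<le> Q" unfolding Q_def using C(1) \<theta> by (intro mult_nonneg_nonneg sum_nonneg) auto
    have count: "finite {x\<in>cylinder N a. (f ^^ k) x \<in> Y ` {1..<N - 1}} \<and>
        real (card {x\<in>cylinder N a. (f ^^ k) x \<in> Y ` {1..<N - 1}}) \<le> Q * \<rho> ^ k"
      if a: "a \<in> {1..<N - 1}" for a k
    proof -
      define n where "n = p * k + m"
      define U where "U = (\<Union>b\<in>{1..<N - 1}. {u\<in>i. (T ^^ n) u = Y b})"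
      have sub: "{x\<in>cylinder N a. (f ^^ k) x \<in> Y ` {1..<N - 1}} \<subseteq> (T ^^ m) ` U"
      proof
        fix x assume x: "x \<in> {x\<in>cylinder N a. (f ^^ k) x \<in> Y ` {1..<N - 1}}"
        then have lx: "real a / real N \<le> x" "x < (real a + 1) / real N"
          using letter_eq_iff[of x N a] N(1) by (auto simp: cylinder_def)
        have "1 / real N \<le> real a / real N" using a by (intro divide_right_mono) auto
        moreover have "real a + 1 \<le> real N - 1" using a by auto
        then have "(real a + 1) / real N \<le> (real N - 1) / real N" by (intro divide_right_mono) auto
        then have "(real a + 1) / real N \<le> 1 - 1 / real N" using N(1) by (simp add: diff_divide_distrib)
        ultimately have "x \<in> (T ^^ m) ` i" using m lx by auto
        then obtain u where u: "u \<in> i" "x = (T ^^ m) u" by blast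
        have "(T ^^ n) u = (f ^^ k) x"
          unfolding n_def f_def funpow_mult u(2) by (simp add: funpow_add)
        then have "u \<in> U" using u x unfolding U_def by auto
        then show "x \<in> (T ^^ m) ` U" using u(2) by blast
      qed
      have finU: "finite U" unfolding U_def using fibre by blast
      have "card U \<le> (\<Sum>b\<in>{1..<N - 1}. card {u\<in>i. (T ^^ n) u = Y b})"
        unfolding U_def by (rule card_UN_le) simp
      then have "real (card U) \<le> (\<Sum>b\<in>{1..<N - 1}. real (card {u\<in>i. (T ^^ n) u = Y b}))"
        by (metis of_nat_mono of_nat_sum)
      also have "\<dots> \<le> (\<Sum>b\<in>{1..<N - 1}. C b * \<theta> ^ n)"
        using fibre by (intro sum_mono) auto
      also have "\<dots> = Q * \<rho> ^ k"
        unfolding sum_distrib_right[symmetric] Q_def \<rho>_def n_def by (simp add: power_add power_mult)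
      finally have "real (card U) \<le> Q * \<rho> ^ k" .
      moreover have "card {x\<in>cylinder N a. (f ^^ k) x \<in> Y ` {1..<N - 1}} \<le> card U"
        using card_mono[OF finite_imageI[OF finU] sub] card_image_le[OF finU, of "T ^^ m"] by linarith
      ultimately show ?thesis using finite_subset[OF sub finite_imageI[OF finU]] by simp
    qed
    obtain D where D: "1 \<le> D" "\<And>n. real (card (itinerary N f n ` {0..1})) \<le> D * \<rho> ^ n"
      using itinerary_growth[OF f _ \<rho> Q count] Y by blast
    \<comment> \<open>Collects the costs that do not grow with n: the constant \<open>D\<close> and
      the one surplus block of p steps.\<close>
    define c where "c = ln D + real p * ln \<theta>"
    have sep: "ln (real (card E)) / real n \<le> ln \<theta> + c / real n"
      if n: "0 < n" and E: "finite E" "separated_set {0..1} T n e E" for n E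
    proof -
      \<comment> \<open>The number of blocks of length p that suffices to contain all times below
        n.\<close>
      define n' where "n' = n div p + 1"
      have E01: "E \<subseteq> {0..1}" using E(2) by (simp add: separated_set_def)
      have "inj_on (itinerary N f n') E"
      proof (rule inj_onI, rule ccontr)
        fix x y assume xy: "x \<in> E" "y \<in> E" "itinerary N f n' x = itinerary N f n' y" "x \<noteq> y"
        then obtain k where k: "k < n" "e < dist ((T ^^ k) x) ((T ^^ k) y)"
          using E(2) unfolding separated_set_def by blast
        define q r where "q = k div p" and "r = k mod p"
        have qr: "r < p" "q < n'" "k = r + p * q"
          using p0 k(1) div_le_mono[of k n p] by (auto simp: q_def r_def n'_def)
        have Tk: "(T ^^ k) z = (T ^^ r) ((f ^^ q) z)" for z
          unfolding qr(3) f_def funpow_mult by (simp add: funpow_add)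
        have in01: "(f ^^ q) x \<in> {0..1}" "(f ^^ q) y \<in> {0..1}"
          using xy E01 funpow_maps_into[OF f(2)] by blast+
        have "letter N ((f ^^ q) x) = letter N ((f ^^ q) y)"
          using xy(3) qr(2) unfolding itinerary_def by simp
        from letter_eq_imp_dist[OF in01 this N(1)] have "dist ((f ^^ q) x) ((f ^^ q) y) < \<delta>"
          using N(2) by simp
        then show False using \<delta>(2)[OF qr(1) in01] k(2) Tk by simp
      qed
      then have "card E \<le> card (itinerary N f n' ` {0..1})"
        using E01 finite_itineraries[OF f(2)] by (intro card_inj_on_le[of "itinerary N f n'"]) auto
      then have cE: "real (card E) \<le> D * \<rho> ^ n'" using D(2)[of n'] by linarith
      have pos: "0 < \<rho>" "1 \<le> D * \<rho> ^ n'" "0 < D"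
        using \<rho> D(1) mult_mono[of 1 D 1 "\<rho> ^ n'"] by auto
      have "ln (real (card E)) \<le> ln (D * \<rho> ^ n')"
      proof (cases "card E = 0")
        \<comment> \<open>The empty set is harmless because \<open>ln 0 = 0\<close> and the
          right-hand side is nonnegative.\<close>
        case True
        then show ?thesis using pos by simp
      next
        case False
        then show ?thesis using cE pos by (intro ln_mono) auto
      qed
      also have "\<dots> = ln D + real (n' * p) * ln \<theta>"
        using pos \<theta> by (simp add: ln_mult ln_realpow \<rho>_def)
      also have "\<dots> \<le> ln D + real (n + p) * ln \<theta>"
      proof -
        have "n div p * p \<le> n" by simp
        then have "n' * p \<le> n + p" unfolding n'_def by simp
        then have "real (n' * p) \<le> real (n + p)" by (rule of_nat_mono)
        then show ?thesis using \<theta> by (intro add_left_mono mult_right_mono) auto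
      qed
      also have "\<dots> = c + real n * ln \<theta>" by (simp add: c_def algebra_simps)
      finally show ?thesis using n by (simp add: field_simps)
    qed
    have "limsup (\<lambda>n. SUP E\<in>{E. finite E \<and> separated_set {0..1} T n e E}.
        ereal (ln (real (card E)) / real n)) \<le> limsup (\<lambda>n. ereal (ln \<theta> + c / real n))"
      by (intro Limsup_mono eventually_mono[OF eventually_gt_at_top[of 0]] SUP_least) (auto intro: sep)
    also have "\<dots> = ereal (ln \<theta>)"
    proof (rule lim_imp_Limsup)
      have "(\<lambda>n. ln \<theta> + c / real n) \<longlonglongrightarrow> ln \<theta> + 0"
        by (intro tendsto_add tendsto_const lim_const_over_n)
      then show "((\<lambda>n. ereal (ln \<theta> + c / real n)) \<longlongrightarrow> ereal (ln \<theta>)) sequentially" by simp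
    qed simp
    finally show ?thesis .
  qed
  then show ?thesis unfolding top_entropy_def by (intro SUP_least) auto
qed

end

section \<open>The Perron value\<close>

text \<open>The empty set is separated and \<open>ln 0 = 0\<close>, so every inner supremum is at
  least 0, even for empty X.\<close>

lemma top_entropy_nonneg: "0 \<le> top_entropy X T"
proof -
  have "0 \<le> limsup (\<lambda>n. SUP E\<in>{E. finite E \<and> separated_set X T n 1 E}.
      ereal (ln (real (card E)) / real n))"
  proof (intro le_Limsup always_eventually allI)
    fix n
    have "ereal (ln (real (card ({} :: 'a set))) / real n) \<le>
        (SUP E\<in>{E. finite E \<and> separated_set X T n 1 E}. ereal (ln (real (card E)) / real n))"
      by (intro SUP_upper) (simp add: separated_set_def)
    then show "0 \<le> (SUP E\<in>{E. finite E \<and> separated_set X T n 1 E}. ereal (ln (real (card E)) / real n))"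
      by (simp add: zero_ereal_def)
  qed simp
  also have "\<dots> \<le> top_entropy X T" unfolding top_entropy_def by (intro SUP_upper) simp
  finally show ?thesis .
qed

text \<open>Iterating the eigenvalue equation shows that the sum of (M^n)_ik v_k over k is l^n v_i;
  a single nonnegative term cannot exceed it.\<close>

lemma lambda_solution_mat_pow_le:
  assumes v: "is_lambda_solution P M l v" and l: "0 < l" and k: "k \<in> P" and i: "i \<in> P"
  shows "mat_pow P M n i k * ennreal (v k) \<le> ennreal (l ^ n * v i)"
  using i
proof (induction n arbitrary: i)
  case 0
  then show ?case by simp
next
  case (Suc n)
  have nonneg: "0 \<le> v j" if "j \<in> P" for j using v that by (simp add: is_lambda_solution_def)
  have sum: "((\<lambda>j. l ^ n * (real (M i j) * v j)) has_sum (l ^ n * (l * v i))) P"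
    using v Suc.prems by (intro has_sum_cmult_right) (simp add: is_lambda_solution_def)
  have "mat_pow P M (Suc n) i k * ennreal (v k) =
      (\<Sum>\<^sub>\<infinity>j\<in>P. of_nat (M i j) * (mat_pow P M n j k * ennreal (v k)))"
    by (simp add: infsum_ennreal_cmult_left[symmetric] mult.assoc)
  also have "\<dots> \<le> (\<Sum>\<^sub>\<infinity>j\<in>P. ennreal (l ^ n * (real (M i j) * v j)))"
  proof (rule infsum_ennreal_mono)
    fix j assume j: "j \<in> P"
    have "of_nat (M i j) * (mat_pow P M n j k * ennreal (v k)) \<le> of_nat (M i j) * ennreal (l ^ n * v j)"
      using Suc.IH[OF j] by (intro mult_left_mono) auto
    also have "\<dots> = ennreal (l ^ n * (real (M i j) * v j))"
      using nonneg[OF j] l by (simp add: ennreal_of_nat_eq_real_of_nat ennreal_mult'[symmetric] algebra_simps)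
    finally show "of_nat (M i j) * (mat_pow P M n j k * ennreal (v k)) \<le> ennreal (l ^ n * (real (M i j) * v j))" .
  qed
  also have "\<dots> \<le> ennreal (l ^ n * (l * v i))"
    unfolding infsum_ennreal_SUP
  proof (rule SUP_least)
    fix F assume "F \<in> {F. finite F \<and> F \<subseteq> P}"
    then have F: "finite F" "F \<subseteq> P" by auto
    have nn: "0 \<le> l ^ n * (real (M i j) * v j)" if "j \<in> P" for j using nonneg[OF that] l by simp
    have "(\<Sum>j\<in>F. ennreal (l ^ n * (real (M i j) * v j))) = ennreal (\<Sum>j\<in>F. l ^ n * (real (M i j) * v j))"
      using F nn by (intro sum_ennreal) auto
    also have "\<dots> \<le> ennreal (l ^ n * (l * v i))"
      using finite_sum_le_has_sum[OF sum F] nn by (intro ennreal_leI) auto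
    finally show "(\<Sum>j\<in>F. ennreal (l ^ n * (real (M i j) * v j))) \<le> ennreal (l ^ n * (l * v i))" .
  qed
  finally show ?case by (simp add: mult.assoc mult.left_commute)
qed

lemma le_mult_of_one_le_ennreal:
  fixes x y z :: ennreal
  assumes "1 \<le> x" "1 \<le> z"
  shows "y \<le> x * (y * z)"
proof -
  have "y \<le> y * z" using mult_left_mono[OF assms(2), of y] by simp
  also have "\<dots> \<le> x * (y * z)" using mult_right_mono[OF assms(1), of "y * z"] by simp
  finally show ?thesis .
qed

context markov_map
begin

lemma partition_nonempty: "P \<noteq> {}"
proof
  assume "P = {}"
  then have "countable {0..1::real}" using countable_uncovered by simp
  then show False using uncountable_closed_interval[of 0 "1::real"] by simp
qed

text \<open>A path from j to k is closed up at i by fixed connections from i to j and from k to i,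
  so one diagonal entry controls every entry up to a constant.\<close>

lemma mat_pow_growth_transfer:
  assumes i: "i \<in> P" and L: "0 \<le> L" "\<And>n. mat_pow P (transition_matrix T) n i i \<le> ennreal (L ^ n)"
    and jk: "j \<in> P" "k \<in> P"
  shows "\<exists>C. 0 \<le> C \<and> (\<forall>n. mat_pow P (transition_matrix T) n j k \<le> ennreal (C * L ^ n))"
proof -
  define M where "M = mat_pow P (transition_matrix T)"
  obtain m1 where m1: "1 \<le> M m1 i j" using mat_pow_eventually_ge_1[OF i jk(1)] unfolding M_def by blast
  obtain m2 where m2: "1 \<le> M m2 k i" using mat_pow_eventually_ge_1[OF jk(2) i] unfolding M_def by blast
  have "M n j k \<le> ennreal ((L ^ m1 * L ^ m2) * L ^ n)" for n
  proof -
    have "M n j k \<le> M m1 i j * (M n j k * M m2 k i)" by (rule le_mult_of_one_le_ennreal[OF m1 m2])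
    also have "\<dots> \<le> M m1 i j * M (n + m2) j i"
      unfolding M_def by (intro mult_left_mono mat_pow_add_ge jk) simp
    also have "\<dots> \<le> M (m1 + (n + m2)) i i" unfolding M_def by (intro mat_pow_add_ge jk)
    also have "\<dots> \<le> ennreal (L ^ (m1 + (n + m2)))" unfolding M_def by (rule L)
    finally show ?thesis by (simp add: power_add algebra_simps)
  qed
  then show ?thesis using L(1) unfolding M_def by (intro exI[of _ "L ^ m1 * L ^ m2"]) auto
qed

text \<open>The return of length N to i is repeated as often as possible, and the remaining time,
  between n1 and n1 + N, is spent on a connection to j. The constant c pays for that time.\<close>

lemma mat_pow_lower_growth:
  assumes i: "i \<in> P" and j: "j \<in> P" and \<theta>: "1 \<le> \<theta>"
    and N: "0 < N" "ennreal (\<theta> ^ N) \<le> mat_pow P (transition_matrix T) N i i"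
  obtains c where "0 < c"
    "eventually (\<lambda>n. ennreal (c * \<theta> ^ n) \<le> mat_pow P (transition_matrix T) n i j) sequentially"
proof -
  define M where "M = mat_pow P (transition_matrix T)"
  obtain n1 where n1: "\<And>m. n1 \<le> m \<Longrightarrow> 1 \<le> M m i j"
    using mat_pow_eventually_ge_1[OF i j] unfolding M_def by blast
  define c where "c = 1 / \<theta> ^ (n1 + N)"
  have "ennreal (c * \<theta> ^ n) \<le> M n i j" if n: "n1 \<le> n" for n
  proof -
    define q r where "q = (n - n1) div N" and "r = n1 + (n - n1) mod N"
    have qr: "n = N * q + r" "n1 \<le> r" "r \<le> n1 + N"
      using n N(1) by (auto simp: q_def r_def less_imp_le)
    have "\<theta> ^ n \<le> \<theta> ^ (n1 + N) * (\<theta> ^ N) ^ q"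
      unfolding power_mult[symmetric] power_add[symmetric] using \<theta> qr by (intro power_increasing) auto
    then have "c * \<theta> ^ n \<le> (\<theta> ^ N) ^ q" using \<theta> by (simp add: c_def field_simps)
    then have "ennreal (c * \<theta> ^ n) \<le> ennreal (\<theta> ^ N) ^ q"
      using \<theta> by (simp add: ennreal_power ennreal_leI)
    also have "\<dots> \<le> M N i i ^ q" using N(2) unfolding M_def by (intro power_mono) auto
    also have "\<dots> \<le> M (N * q) i i" unfolding M_def by (rule mat_pow_power_le[OF i])
    also have "\<dots> \<le> M (N * q) i i * M r i j"
      using mult_left_mono[OF n1[OF qr(2)], of "M (N * q) i i"] by simp
    also have "\<dots> \<le> M n i j" unfolding M_def qr(1) by (rule mat_pow_add_ge[OF i])
    finally show ?thesis .
  qed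
  moreover have "0 < c" using \<theta> by (simp add: c_def)
  ultimately show ?thesis using that unfolding M_def eventually_sequentially by blast
qed

text \<open>The horseshoe bound gives the upper estimate and all finiteness claims. For the lower
  estimate, diagonal entries bounded by \<theta>^n with \<theta> < exp h would force the entropy
  down to ln \<theta>; so some power beats \<theta>^N, and repeating it propagates the growth to all
  large n.\<close>

lemma is_perron_value_exp_entropy:
  assumes h: "top_entropy {0..1} T = ereal h"
  shows "is_perron_value P (transition_matrix T) (exp h)"
proof -
  define M where "M = mat_pow P (transition_matrix T)"
  define L where "L = exp h"
  have h0: "0 \<le> h" using top_entropy_nonneg[of "{0..1}" T] h by simp
  have L: "1 \<le> L" using h0 by (simp add: L_def)
  have diag: "M n i i \<le> ennreal (L ^ n)" if "i \<in> P" for i n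
    unfolding M_def L_def using mat_pow_le_exp_entropy[OF that _ h0] h by simp
  have upper: "\<exists>C. 0 \<le> C \<and> (\<forall>n. M n i j \<le> ennreal (C * L ^ n))" if "i \<in> P" "j \<in> P" for i j
    using mat_pow_growth_transfer[OF that(1) _ _ that] diag[OF that(1)] L unfolding M_def by simp
  have fin: "M n i j < \<infinity>" if "i \<in> P" "j \<in> P" for n i j
    using upper[OF that] by (metis ennreal_less_top infinity_ennreal_def le_less_trans)
  define a where "a n i j = enn2real (M n i j)" for n i j
  have a_eq: "M n i j = ennreal (a n i j)" if "i \<in> P" "j \<in> P" for n i j
    unfolding a_def using fin[OF that] by (simp add: less_top)
  have a0: "0 \<le> a n i j" for n i j by (simp add: a_def)
  have root_le: "root n (a n i i) \<le> L" if "i \<in> P" "0 < n" for n i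
  proof -
    have "a n i i \<le> L ^ n" using diag[OF that(1), of n] a_eq[OF that(1,1)] L by simp
    then have "root n (a n i i) \<le> root n (L ^ n)" using that(2) by (intro real_root_le_mono)
    then show ?thesis using L that(2) by (simp add: real_root_power_cancel)
  qed
  have lim: "(\<lambda>n. root n (a n i j)) \<longlonglongrightarrow> L" if ij: "i \<in> P" "j \<in> P" for i j
  proof (rule order_tendstoI)
    fix x assume x: "L < x"
    obtain C where C: "0 \<le> C" "\<And>n. M n i j \<le> ennreal (C * L ^ n)" using upper[OF ij] by blast
    \<comment> \<open>\<open>C\<close> may be 0, and the n-th root tends to 1 only for a positive
      constant.\<close>
    define C' where "C' = C + 1"
    have C': "0 < C'" using C(1) by (simp add: C'_def)
    have "a n i j \<le> C' * L ^ n" for n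
    proof -
      have "a n i j \<le> C * L ^ n" using C(1) C(2)[of n] a_eq[OF ij] L by simp
      also have "\<dots> \<le> C' * L ^ n" using L by (intro mult_right_mono) (auto simp: C'_def)
      finally show ?thesis .
    qed
    then have le: "root n (a n i j) \<le> root n C' * L" if "0 < n" for n
      using real_root_le_mono[OF that, of "a n i j" "C' * L ^ n"] L that
      by (simp add: real_root_mult real_root_power_cancel)
    have "(\<lambda>n. root n C' * L) \<longlonglongrightarrow> 1 * L" by (intro tendsto_mult tendsto_const LIMSEQ_root_const C')
    then have "eventually (\<lambda>n. root n C' * L < x) sequentially" using x by (intro order_tendstoD(2)) auto
    then show "eventually (\<lambda>n. root n (a n i j) < x) sequentially"
      using eventually_gt_at_top[of 0]
    proof eventually_elim
      case (elim n)
      then show ?case using le[of n] by linarith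
    qed
  next
    fix x assume x: "x < L"
    show "eventually (\<lambda>n. x < root n (a n i j)) sequentially"
    \<comment> \<open>The entropy estimate needs \<theta> > 1; below 1 it is enough that the entries
      are eventually at least 1.\<close>
    proof (cases "x < 1")
      case True
      obtain n1 where n1: "\<And>m. n1 \<le> m \<Longrightarrow> 1 \<le> M m i j"
        using mat_pow_eventually_ge_1[OF ij] unfolding M_def by blast
      have "x < root n (a n i j)" if n: "n1 \<le> n" "0 < n" for n
      proof -
        have "1 \<le> a n i j" using n1[OF n(1)] a_eq[OF ij] by simp
        then have "1 \<le> root n (a n i j)" using n(2) by simp
        then show ?thesis using True by linarith
      qed
      then have "\<forall>n\<ge>Suc n1. x < root n (a n i j)" by simp
      then show ?thesis unfolding eventually_sequentially by blast
    next
      case False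
      \<comment> \<open>Strictly between x and L: below L for the contradiction with the entropy,
        above x to absorb the factor \<open>root n c\<close>, which tends to 1.\<close>
      define \<theta> where "\<theta> = (x + L) / 2"
      have \<theta>: "1 < \<theta>" "\<theta> < L" "x < \<theta>" using x False by (auto simp: \<theta>_def)
      have "\<exists>N. \<not> M N i i \<le> ennreal (\<theta> ^ N)"
      proof (rule ccontr)
        assume "\<nexists>N. \<not> M N i i \<le> ennreal (\<theta> ^ N)"
        then have "top_entropy {0..1} T \<le> ereal (ln \<theta>)"
          using \<theta>(1) mat_pow_growth_transfer[OF ij(1), of \<theta>] unfolding M_def
          by (intro top_entropy_le_ln_growth partition_nonempty) auto
        then have "L \<le> \<theta>" using h \<theta>(1) by (simp add: L_def ln_ge_iff)
        then show False using \<theta>(2) by simp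
      qed
      then obtain N where N: "\<not> M N i i \<le> ennreal (\<theta> ^ N)" by blast
      have "N \<noteq> 0" using N by (intro notI) (simp add: M_def)
      then have N': "0 < N" "ennreal (\<theta> ^ N) \<le> mat_pow P (transition_matrix T) N i i"
        using N by (simp_all add: M_def not_le less_imp_le)
      obtain c where c: "0 < c" "eventually (\<lambda>n. ennreal (c * \<theta> ^ n) \<le> M n i j) sequentially"
        unfolding M_def using mat_pow_lower_growth[OF ij less_imp_le[OF \<theta>(1)] N'] .
      have "(\<lambda>n. root n c * \<theta>) \<longlonglongrightarrow> 1 * \<theta>" by (intro tendsto_mult tendsto_const LIMSEQ_root_const c)
      then have "eventually (\<lambda>n. x < root n c * \<theta>) sequentially" using \<theta> by (intro order_tendstoD(1)) auto
      then show ?thesis using c(2) eventually_gt_at_top[of 0]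
      proof eventually_elim
        case (elim n)
        have "c * \<theta> ^ n \<le> a n i j" using elim(2) a_eq[OF ij] a0 by simp
        then have "root n (c * \<theta> ^ n) \<le> root n (a n i j)" using elim(3) by (intro real_root_le_mono)
        moreover have "root n (c * \<theta> ^ n) = root n c * \<theta>"
          using elim(3) \<theta>(1) by (simp add: real_root_mult real_root_power_cancel)
        ultimately show ?case using elim(1) by simp
      qed
    qed
  qed
  have sup: "L = (SUP n\<in>{1..}. root n (a n i i))" if i: "i \<in> P" for i
  proof (rule antisym)
    have bdd: "bdd_above ((\<lambda>n. root n (a n i i)) ` {1..})"
      using root_le[OF i] by (intro bdd_aboveI[of _ L]) auto
    have "root n (a n i i) \<le> (SUP n\<in>{1..}. root n (a n i i))" if "1 \<le> n" for n
      using that by (intro cSUP_upper bdd) simp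
    then show "L \<le> (SUP n\<in>{1..}. root n (a n i i))"
      by (intro LIMSEQ_le_const2[OF lim[OF i i]]) blast
    show "(SUP n\<in>{1..}. root n (a n i i)) \<le> L"
      using root_le[OF i] by (intro cSUP_least) auto
  qed
  show ?thesis
    unfolding is_perron_value_def M_def[symmetric] a_def[symmetric] L_def[symmetric]
    by (intro conjI ballI allI fin lim sup)
qed

lemma perron_value_le_lambda:
  assumes L: "is_perron_value P (transition_matrix T) L"
    and l: "0 < l" and v: "is_lambda_solution P (transition_matrix T) l v"
  shows "L \<le> l"
proof -
  define M where "M = mat_pow P (transition_matrix T)"
  \<comment> \<open>A positive coordinate can be cancelled from (M^n)_ii v_i <= l^n v_i, leaving a
    bound on the diagonal entry alone.\<close>
  obtain i where i: "i \<in> P" "0 < v i"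
    using v unfolding is_lambda_solution_def by (metis less_eq_real_def)
  define a where "a n = enn2real (M n i i)" for n
  have lim: "(\<lambda>n. root n (a n)) \<longlonglongrightarrow> L" and fin: "\<And>n. M n i i < \<infinity>"
    using L i unfolding is_perron_value_def a_def M_def by auto
  have "root n (a n) \<le> l" if n: "0 < n" for n
  proof -
    have eq: "M n i i = ennreal (a n)" unfolding a_def using fin by (simp add: less_top)
    have "ennreal (a n * v i) \<le> ennreal (l ^ n * v i)"
      using lambda_solution_mat_pow_le[OF v l i(1) i(1), of n] eq i(2)
      unfolding M_def[symmetric] by (simp add: ennreal_mult'' less_imp_le)
    then have "a n * v i \<le> l ^ n * v i" using l i(2) by simp
    then have "a n \<le> l ^ n" using i(2) by simp
    then have "root n (a n) \<le> root n (l ^ n)" using n by (intro real_root_le_mono)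
    then show ?thesis using l n by (simp add: real_root_power_cancel)
  qed
  then show ?thesis using lim by (intro LIMSEQ_le_const2[OF lim] exI[of _ 1]) auto
qed

end

theorem proposition8:
  fixes T :: "real \<Rightarrow> real" and P :: "real set set"
  assumes "T \<in> CPMM" and "markov_partition T P"
  shows "perron_value P (transition_matrix T) = exp (real_of_ereal (top_entropy {0..1} T)) \<and>
    (\<forall>l::real. l > 0 \<longrightarrow>
       (\<exists>v. is_lambda_solution P (transition_matrix T) l v \<and> v summable_on P) \<longrightarrow>
       perron_value P (transition_matrix T) \<le> l)"
proof -
  interpret markov_map T P
    using assms by unfold_locales (simp_all add: CPMM_def)
  have "top_entropy {0..1} T < \<infinity>" using assms(1) by (simp add: CPMM_def)
  \<comment> \<open>Finite and nonnegative, the entropy is a real number, so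
    \<open>real_of_ereal\<close> does not fall back on its default value at infinity.\<close>
  then have h: "top_entropy {0..1} T = ereal (real_of_ereal (top_entropy {0..1} T))"
    using top_entropy_nonneg[of "{0..1}" T] by (cases "top_entropy {0..1} T") auto
  note perron = is_perron_value_exp_entropy[OF h]
  have "perron_value P (transition_matrix T) = exp (real_of_ereal (top_entropy {0..1} T))"
    by (rule perron_value_eqI[OF perron partition_nonempty])
  then show ?thesis using perron_value_le_lambda[OF perron] by auto
qed

end
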